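(* Let $X_1,\dots,X_n$ and $Y$ be Banach spaces over the same field $\mathbb K$. Then: (i) $\Gamma(\cdot)$ is a norm on the linear space $\Gamma(X_1,\dots,X_n;Y)$. (ii) For every $\varphi\in\mathcal L(X_1,\dots,X_n)$ and $y\in Y$, the rank-one multilinear operator $\varphi\cdot y:X_1\times\dots\times X_n\to Y$, $(x^1,\dots,x^n)\mapsto\varphi(x^1,\dots,x^n)\,y$, is an element of $\Gamma(X_1,\dots,X_n;Y)$ and $\Gamma(\varphi\cdot y)\le\|\varphi\|\,\|y\|$. (iii) $\|T\|\le\Gamma(T)$ for all $T\in\Gamma(X_1,\dots,X_n;Y)$. (iv) Let $Z_1,\dots,Z_m,W$ be Banach spaces. Let $R:Z_1\times\dots\times Z_m\to X_1\widehat\otimes_\pi\dots\widehat\otimes_\pi X_n$ be a bounded multilinear operator such that $R(Z_1\times\dots\times Z_m)\subset\Sigma_{X_1\dots X_n}$, and let $S:Y\to W$ be a bounded linear operator. If $T\in\Gamma(X_1,\dots,X_n;Y)$, then $S f_T R:Z_1\times\dots\times Z_m\to W$ is an element of $\Gamma(Z_1,\dots,Z_m;W)$ and $\Gamma(Sf_TR)\le\|R\|\,\Gamma(T)\,\|S\|$.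
   Context: $\mathbb K$ is $\mathbb R$ or $\mathbb C$; $n,m$ are positive integers. $\mathcal L(X_1,\dots,X_n)$ is the space of bounded multilinear forms on $X_1\times\dots\times X_n$; the norm of a bounded multilinear operator is $\|T\|=\sup\{\|T(x^1,\dots,x^n)\|:\|x^i\|\le1\}$. $X_1\widehat\otimes_\pi\dots\widehat\otimes_\pi X_n$ is the completed projective tensor product, and $\Sigma_{X_1\dots X_n}=\{x^1\otimes\dots\otimes x^n: x^i\in X_i\}$ is the set of decomposable tensors. For a bounded multilinear $T:X_1\times\dots\times X_n\to Y$, $f_T:\Sigma_{X_1\dots X_n}\to Y$ is the well-defined map $f_T(x^1\otimes\dots\otimes x^n)=T(x^1,\dots,x^n)$ (the restriction to $\Sigma_{X_1\dots X_n}$ of the linearization of $T$). A multilinear operator $T:X_1\times\dots\times X_n\to Y$ factors through a Hilbert space if there exist a Hilbert space $H$, a subset $M\subset H$, a bounded multilinear operator $A:X_1\times\dots\times X_n\to H$ with $A(X_1\times\dots\times X_n)\subset M$, and a Lipschitz function $B:M\to Y$ such that $T=B\circ A$. Then $\Gamma(T)=\inf\|A\|\,\mathrm{Lip}(B)$, the infimum over all such factorizations, where $\mathrm{Lip}(B)$ is the least Lipschitz constant. $\Gamma(X_1,\dots,X_n;Y)$ is the collection of all $T:X_1\times\dots\times X_n\to Y$ that factor through a Hilbert space. *)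

theory Defs
  imports Complex_Main "HOL-Library.FuncSet" "HOL-Algebra.Module"
begin

section \<open>Normed, Banach and Hilbert spaces with carriers\<close>

text \<open>
  The spaces \<open>X\<^sub>1, \<dots>, X\<^sub>n\<close> are different Banach spaces and \<open>n\<close> is arbitrary, so spaces are
  records with a carrier; a finite list of spaces is a function on \<open>{1..n}\<close> whose values have their
  carriers in one common type (which loses nothing: finitely many spaces can be moved to disjoint
  parts of one type). The scalar field is a subset \<open>K\<close> of the complex numbers,
  \<open>K = \<real>\<close> or \<open>K = UNIV\<close>; only scalars in \<open>K\<close> act. The fields \<open>mult\<close> and \<open>one\<close>, which
  HOL-Algebra modules inherit from rings, play no role for vector spaces.
\<close>

record 'a nspace = "(complex, 'a) module" +
  vnorm :: "'a \<Rightarrow> real"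

text \<open>One record serves as the ring of scalars and as the one-dimensional Banach space \<open>K\<close>.\<close>

definition scalar_field :: "complex set \<Rightarrow> complex nspace" where
  "scalar_field K = \<lparr>carrier = K, mult = (*), one = 1, zero = 0, add = (+), smult = (*), vnorm = cmod\<rparr>"

locale normed_space = module "scalar_field K" V
  for K :: "complex set" and V :: "'a nspace" (structure) +
  assumes vnorm_nonneg: "x \<in> carrier V \<Longrightarrow> 0 \<le> vnorm V x"
    and vnorm_eq_0_iff: "x \<in> carrier V \<Longrightarrow> vnorm V x = 0 \<longleftrightarrow> x = \<zero>\<^bsub>V\<^esub>"
    and vnorm_smult: "c \<in> K \<Longrightarrow> x \<in> carrier V \<Longrightarrow> vnorm V (c \<odot>\<^bsub>V\<^esub> x) = cmod c * vnorm V x"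
    and vnorm_triangle:
      "x \<in> carrier V \<Longrightarrow> y \<in> carrier V \<Longrightarrow> vnorm V (x \<oplus>\<^bsub>V\<^esub> y) \<le> vnorm V x + vnorm V y"

definition vdist :: "'a nspace \<Rightarrow> 'a \<Rightarrow> 'a \<Rightarrow> real" where
  "vdist V x y = vnorm V (x \<ominus>\<^bsub>V\<^esub> y)"

definition vCauchy :: "'a nspace \<Rightarrow> (nat \<Rightarrow> 'a) \<Rightarrow> bool" where
  "vCauchy V s \<longleftrightarrow> (\<forall>k. s k \<in> carrier V) \<and>
     (\<forall>e>0. \<exists>N. \<forall>i\<ge>N. \<forall>j\<ge>N. vdist V (s i) (s j) < e)"

locale banach_space = normed_space +
  assumes complete: "vCauchy V s \<Longrightarrow> \<exists>l\<in>carrier V. (\<lambda>k. vdist V (s k) l) \<longlonglongrightarrow> 0"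

definition inner_product :: "complex set \<Rightarrow> 'a nspace \<Rightarrow> ('a \<Rightarrow> 'a \<Rightarrow> complex) \<Rightarrow> bool" where
  "inner_product K V ip \<longleftrightarrow>
     (\<forall>x\<in>carrier V. \<forall>y\<in>carrier V. ip x y \<in> K \<and> ip y x = cnj (ip x y)) \<and>
     (\<forall>x\<in>carrier V. \<forall>y\<in>carrier V. \<forall>z\<in>carrier V. ip (x \<oplus>\<^bsub>V\<^esub> y) z = ip x z + ip y z) \<and>
     (\<forall>c\<in>K. \<forall>x\<in>carrier V. \<forall>y\<in>carrier V. ip (c \<odot>\<^bsub>V\<^esub> x) y = c * ip x y)"

locale hilbert_space = banach_space +
  assumes norm_from_inner:
    "\<exists>ip. inner_product K V ip \<and> (\<forall>x\<in>carrier V. ip x x = complex_of_real ((vnorm V x)\<^sup>2))"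


section \<open>Bounded linear and multilinear operators\<close>

definition bounded_linear_op ::
    "complex set \<Rightarrow> 'a nspace \<Rightarrow> 'b nspace \<Rightarrow> ('a \<Rightarrow> 'b) \<Rightarrow> bool" where
  "bounded_linear_op K V W S \<longleftrightarrow>
     S \<in> carrier V \<rightarrow> carrier W \<and>
     (\<forall>x\<in>carrier V. \<forall>y\<in>carrier V. S (x \<oplus>\<^bsub>V\<^esub> y) = S x \<oplus>\<^bsub>W\<^esub> S y) \<and>
     (\<forall>c\<in>K. \<forall>x\<in>carrier V. S (c \<odot>\<^bsub>V\<^esub> x) = c \<odot>\<^bsub>W\<^esub> S x) \<and>
     bdd_above ((\<lambda>x. vnorm W (S x)) ` {x \<in> carrier V. vnorm V x \<le> 1})"

definition opnorm :: "'a nspace \<Rightarrow> 'b nspace \<Rightarrow> ('a \<Rightarrow> 'b) \<Rightarrow> real" where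
  "opnorm V W S = Sup ((\<lambda>x. vnorm W (S x)) ` {x \<in> carrier V. vnorm V x \<le> 1})"

definition tuples :: "nat \<Rightarrow> (nat \<Rightarrow> 'a nspace) \<Rightarrow> (nat \<Rightarrow> 'a) set" where
  "tuples n X = (\<Pi>\<^sub>E i\<in>{1..n}. carrier (X i))"

definition multilinear ::
    "complex set \<Rightarrow> nat \<Rightarrow> (nat \<Rightarrow> 'a nspace) \<Rightarrow> 'b nspace \<Rightarrow> ((nat \<Rightarrow> 'a) \<Rightarrow> 'b) \<Rightarrow> bool" where
  "multilinear K n X Y T \<longleftrightarrow>
     T \<in> tuples n X \<rightarrow> carrier Y \<and>
     (\<forall>x\<in>tuples n X. \<forall>i\<in>{1..n}. \<forall>a\<in>carrier (X i). \<forall>b\<in>carrier (X i).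
        T (x(i := a \<oplus>\<^bsub>X i\<^esub> b)) = T (x(i := a)) \<oplus>\<^bsub>Y\<^esub> T (x(i := b))) \<and>
     (\<forall>x\<in>tuples n X. \<forall>i\<in>{1..n}. \<forall>c\<in>K. \<forall>a\<in>carrier (X i).
        T (x(i := c \<odot>\<^bsub>X i\<^esub> a)) = c \<odot>\<^bsub>Y\<^esub> T (x(i := a)))"

definition unit_tuples :: "nat \<Rightarrow> (nat \<Rightarrow> 'a nspace) \<Rightarrow> (nat \<Rightarrow> 'a) set" where
  "unit_tuples n X = {x \<in> tuples n X. \<forall>i\<in>{1..n}. vnorm (X i) (x i) \<le> 1}"

definition bounded_multilinear ::
    "complex set \<Rightarrow> nat \<Rightarrow> (nat \<Rightarrow> 'a nspace) \<Rightarrow> 'b nspace \<Rightarrow> ((nat \<Rightarrow> 'a) \<Rightarrow> 'b) \<Rightarrow> bool" where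
  "bounded_multilinear K n X Y T \<longleftrightarrow>
     multilinear K n X Y T \<and> bdd_above ((\<lambda>x. vnorm Y (T x)) ` unit_tuples n X)"

definition mnorm :: "nat \<Rightarrow> (nat \<Rightarrow> 'a nspace) \<Rightarrow> 'b nspace \<Rightarrow> ((nat \<Rightarrow> 'a) \<Rightarrow> 'b) \<Rightarrow> real" where
  "mnorm n X Y T = Sup ((\<lambda>x. vnorm Y (T x)) ` unit_tuples n X)"


section \<open>The completed projective tensor product\<close>

text \<open>
  Formal \<open>K\<close>-linear combinations of tuples, i.e. the free vector space on
  \<open>X\<^sub>1 \<times> \<dots> \<times> X\<^sub>n\<close>, and in it the span of the relations that make the tensor map multilinear.
\<close>

definition formal_sums :: "complex set \<Rightarrow> nat \<Rightarrow> (nat \<Rightarrow> 'a nspace) \<Rightarrow> ((nat \<Rightarrow> 'a) \<Rightarrow> complex) set" where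
  "formal_sums K n X =
     {u. finite {x. u x \<noteq> 0} \<and> {x. u x \<noteq> 0} \<subseteq> tuples n X \<and> range u \<subseteq> K}"

definition single :: "(nat \<Rightarrow> 'a) \<Rightarrow> (nat \<Rightarrow> 'a) \<Rightarrow> complex" where
  "single x = (\<lambda>z. if z = x then 1 else 0)"

inductive_set multilinear_relations ::
    "complex set \<Rightarrow> nat \<Rightarrow> (nat \<Rightarrow> 'a nspace) \<Rightarrow> ((nat \<Rightarrow> 'a) \<Rightarrow> complex) set"
  for K :: "complex set" and n :: nat and X :: "nat \<Rightarrow> 'a nspace" where
  zero: "(\<lambda>z. 0) \<in> multilinear_relations K n X"
| add: "\<lbrakk>u \<in> multilinear_relations K n X; c \<in> K; x \<in> tuples n X; i \<in> {1..n};
         a \<in> carrier (X i); b \<in> carrier (X i)\<rbrakk> \<Longrightarrow>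
    (\<lambda>z. u z + c * (single (x(i := a \<oplus>\<^bsub>X i\<^esub> b)) z - single (x(i := a)) z - single (x(i := b)) z))
      \<in> multilinear_relations K n X"
| smult: "\<lbrakk>u \<in> multilinear_relations K n X; c \<in> K; x \<in> tuples n X; i \<in> {1..n};
         r \<in> K; a \<in> carrier (X i)\<rbrakk> \<Longrightarrow>
    (\<lambda>z. u z + c * (single (x(i := r \<odot>\<^bsub>X i\<^esub> a)) z - r * single (x(i := a)) z))
      \<in> multilinear_relations K n X"

definition tensor_rel ::
    "complex set \<Rightarrow> nat \<Rightarrow> (nat \<Rightarrow> 'a nspace) \<Rightarrow>
     (((nat \<Rightarrow> 'a) \<Rightarrow> complex) \<times> ((nat \<Rightarrow> 'a) \<Rightarrow> complex)) set" where
  "tensor_rel K n X =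
     {(u, v). u \<in> formal_sums K n X \<and> v \<in> formal_sums K n X \<and>
              (\<lambda>z. u z - v z) \<in> multilinear_relations K n X}"

text \<open>
  The algebraic tensor product with the projective norm. A tensor is the set of all formal sums
  that represent it, and a formal sum \<open>v\<close> represents \<open>\<Sum>\<^sub>x v(x) x\<^sub>1 \<otimes> \<dots> \<otimes> x\<^sub>n\<close>; the coefficient
  \<open>v(x)\<close> could be absorbed into \<open>x\<^sub>1\<close>, whence its modulus in the norm. The unions below are over
  representatives and do not depend on them.
\<close>

definition projective_tensor ::
    "complex set \<Rightarrow> nat \<Rightarrow> (nat \<Rightarrow> 'a nspace) \<Rightarrow> ((nat \<Rightarrow> 'a) \<Rightarrow> complex) set nspace" where
  "projective_tensor K n X =
     \<lparr>carrier = formal_sums K n X // tensor_rel K n X,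
      mult = undefined, one = undefined,
      zero = tensor_rel K n X `` {\<lambda>z. 0},
      add = (\<lambda>s t. \<Union>u\<in>s. \<Union>v\<in>t. tensor_rel K n X `` {\<lambda>z. u z + v z}),
      smult = (\<lambda>c s. \<Union>u\<in>s. tensor_rel K n X `` {\<lambda>z. c * u z}),
      vnorm = (\<lambda>s. Inf ((\<lambda>v. \<Sum>x | v x \<noteq> 0. cmod (v x) * (\<Prod>i=1..n. vnorm (X i) (x i))) ` s))\<rparr>"

definition cauchy_rel :: "'a nspace \<Rightarrow> ((nat \<Rightarrow> 'a) \<times> (nat \<Rightarrow> 'a)) set" where
  "cauchy_rel V = {(s, t). vCauchy V s \<and> vCauchy V t \<and> (\<lambda>k. vdist V (s k) (t k)) \<longlonglongrightarrow> 0}"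

definition completion :: "'a nspace \<Rightarrow> (nat \<Rightarrow> 'a) set nspace" where
  "completion V =
     \<lparr>carrier = Collect (vCauchy V) // cauchy_rel V,
      mult = undefined, one = undefined,
      zero = cauchy_rel V `` {\<lambda>k. \<zero>\<^bsub>V\<^esub>},
      add = (\<lambda>p q. \<Union>s\<in>p. \<Union>t\<in>q. cauchy_rel V `` {\<lambda>k. s k \<oplus>\<^bsub>V\<^esub> t k}),
      smult = (\<lambda>c p. \<Union>s\<in>p. cauchy_rel V `` {\<lambda>k. c \<odot>\<^bsub>V\<^esub> s k}),
      vnorm = (\<lambda>p. THE r. \<exists>s\<in>p. (\<lambda>k. vnorm V (s k)) \<longlonglongrightarrow> r)\<rparr>"

type_synonym 'a ptensor = "(nat \<Rightarrow> ((nat \<Rightarrow> 'a) \<Rightarrow> complex) set) set"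

definition completed_projective_tensor ::
    "complex set \<Rightarrow> nat \<Rightarrow> (nat \<Rightarrow> 'a nspace) \<Rightarrow> 'a ptensor nspace" where
  "completed_projective_tensor K n X = completion (projective_tensor K n X)"

text \<open>\<open>pure_tensor K n X x\<close> is \<open>x\<^sub>1 \<otimes> \<dots> \<otimes> x\<^sub>n\<close>, embedded into the completion as a constant sequence.\<close>

definition pure_tensor :: "complex set \<Rightarrow> nat \<Rightarrow> (nat \<Rightarrow> 'a nspace) \<Rightarrow> (nat \<Rightarrow> 'a) \<Rightarrow> 'a ptensor" where
  "pure_tensor K n X x =
     cauchy_rel (projective_tensor K n X) `` {\<lambda>k. tensor_rel K n X `` {single x}}"

definition decomposable_tensors :: "complex set \<Rightarrow> nat \<Rightarrow> (nat \<Rightarrow> 'a nspace) \<Rightarrow> 'a ptensor set" where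
  "decomposable_tensors K n X = pure_tensor K n X ` tuples n X"

definition tensor_map ::
    "complex set \<Rightarrow> nat \<Rightarrow> (nat \<Rightarrow> 'a nspace) \<Rightarrow> ((nat \<Rightarrow> 'a) \<Rightarrow> 'b) \<Rightarrow> 'a ptensor \<Rightarrow> 'b" where
  "tensor_map K n X T p = (THE y. \<exists>x\<in>tuples n X. pure_tensor K n X x = p \<and> y = T x)"


section \<open>Factorization through a Hilbert space\<close>

definition lip_consts :: "'a nspace \<Rightarrow> 'b nspace \<Rightarrow> 'a set \<Rightarrow> ('a \<Rightarrow> 'b) \<Rightarrow> real set" where
  "lip_consts H Y M B = {L. 0 \<le> L \<and> (\<forall>x\<in>M. \<forall>y\<in>M. vdist Y (B x) (B y) \<le> L * vdist H x y)}"

definition Lip :: "'a nspace \<Rightarrow> 'b nspace \<Rightarrow> 'a set \<Rightarrow> ('a \<Rightarrow> 'b) \<Rightarrow> real" where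
  "Lip H Y M B = Inf (lip_consts H Y M B)"

definition hilbert_factorization ::
    "complex set \<Rightarrow> nat \<Rightarrow> (nat \<Rightarrow> 'a nspace) \<Rightarrow> 'b nspace \<Rightarrow> ((nat \<Rightarrow> 'a) \<Rightarrow> 'b) \<Rightarrow>
     'h nspace \<Rightarrow> 'h set \<Rightarrow> ((nat \<Rightarrow> 'a) \<Rightarrow> 'h) \<Rightarrow> ('h \<Rightarrow> 'b) \<Rightarrow> bool" where
  "hilbert_factorization K n X Y T H M A B \<longleftrightarrow>
     hilbert_space K H \<and> M \<subseteq> carrier H \<and>
     bounded_multilinear K n X H A \<and> A ` tuples n X \<subseteq> M \<and>
     B \<in> M \<rightarrow> carrier Y \<and> lip_consts H Y M B \<noteq> {} \<and>
     (\<forall>x\<in>tuples n X. T x = B (A x))"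

text \<open>
  A definition cannot quantify over all types \<open>'h\<close> of vectors of \<open>H\<close>, so Hilbert spaces are taken
  with carrier in the type below, which depends on the \<open>X\<^sub>i\<close> only. This restricts neither the set of
  factorizable operators nor the infimum: replace \<open>H\<close> by the closed linear span of the range of
  \<open>A\<close>, each point of which is the limit of a sequence of formal sums. The lemma
  \<open>hilbert_factorization_universal\<close> below proves this.
\<close>

type_synonym 'a hvec = "nat \<Rightarrow> (nat \<Rightarrow> 'a) \<Rightarrow> complex"

definition factors_through_hilbert ::
    "complex set \<Rightarrow> nat \<Rightarrow> (nat \<Rightarrow> 'a nspace) \<Rightarrow> 'b nspace \<Rightarrow> ((nat \<Rightarrow> 'a) \<Rightarrow> 'b) \<Rightarrow> bool" where
  "factors_through_hilbert K n X Y T \<longleftrightarrow>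
     (\<exists>(H :: 'a hvec nspace) M A B. hilbert_factorization K n X Y T H M A B)"

definition Gamma_norm ::
    "complex set \<Rightarrow> nat \<Rightarrow> (nat \<Rightarrow> 'a nspace) \<Rightarrow> 'b nspace \<Rightarrow> ((nat \<Rightarrow> 'a) \<Rightarrow> 'b) \<Rightarrow> real" where
  "Gamma_norm K n X Y T =
     Inf {mnorm n X H A * Lip H Y M B | (H :: 'a hvec nspace) M A B.
            hilbert_factorization K n X Y T H M A B}"

text \<open>
  The operators are made extensional (\<open>undefined\<close> off \<open>X\<^sub>1 \<times> \<dots> \<times> X\<^sub>n\<close>) so that equality of
  elements is equality of operators.
\<close>

definition Gamma_space ::
    "complex set \<Rightarrow> nat \<Rightarrow> (nat \<Rightarrow> 'a nspace) \<Rightarrow> 'b nspace \<Rightarrow> ((nat \<Rightarrow> 'a) \<Rightarrow> 'b) nspace" where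
  "Gamma_space K n X Y =
     \<lparr>carrier = {T \<in> extensional (tuples n X).
                   multilinear K n X Y T \<and> factors_through_hilbert K n X Y T},
      mult = undefined, one = undefined,
      zero = (\<lambda>x\<in>tuples n X. \<zero>\<^bsub>Y\<^esub>),
      add = (\<lambda>S T. \<lambda>x\<in>tuples n X. S x \<oplus>\<^bsub>Y\<^esub> T x),
      smult = (\<lambda>c T. \<lambda>x\<in>tuples n X. c \<odot>\<^bsub>Y\<^esub> T x),
      vnorm = Gamma_norm K n X Y\<rparr>"


section \<open>The choice of carrier type for the Hilbert spaces loses nothing\<close>

lemma (in normed_space) minus_conv:
  assumes "x \<in> carrier V" "y \<in> carrier V" "-1 \<in> K"
  shows "x \<ominus>\<^bsub>V\<^esub> y = x \<oplus>\<^bsub>V\<^esub> ((-1) \<odot>\<^bsub>V\<^esub> y)"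
proof -
  have "y \<oplus>\<^bsub>V\<^esub> ((-1) \<odot>\<^bsub>V\<^esub> y) = \<zero>\<^bsub>V\<^esub>"
    using smult_l_distr[of 1 "-1" y] smult_one[of y] smult_l_null[of y] assms R.one_closed
    by (simp add: scalar_field_def)
  moreover have "(-1) \<odot>\<^bsub>V\<^esub> y \<in> carrier V"
    using assms smult_closed[of "-1" y] by (simp add: scalar_field_def)
  ultimately have "\<ominus>\<^bsub>V\<^esub> y = (-1) \<odot>\<^bsub>V\<^esub> y"
    using assms(2) M.minus_equality M.a_comm by metis
  then show ?thesis by (simp add: a_minus_def)
qed

lemma scalar_field_cring:
  assumes "K = \<real> \<or> K = UNIV"
  shows "cring (scalar_field K)"
proof (rule cringI)
  have neg: "- x \<in> K" if "x \<in> K" for x using assms that by auto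
  show "abelian_group (scalar_field K)"
    using assms by (intro abelian_groupI) (auto simp: scalar_field_def intro!: bexI[OF _ neg])
  show "comm_monoid (scalar_field K)"
    using assms by (intro comm_monoidI) (auto simp: scalar_field_def)
qed (auto simp: scalar_field_def algebra_simps)

definition image_space :: "('h \<Rightarrow> 'k) \<Rightarrow> 'h set \<Rightarrow> 'h nspace \<Rightarrow> 'k nspace" where
  "image_space f H0 H = (let g = inv_into H0 f in
     \<lparr>carrier = f ` H0, mult = undefined, one = undefined, zero = f \<zero>\<^bsub>H\<^esub>,
      add = (\<lambda>s t. f (g s \<oplus>\<^bsub>H\<^esub> g t)), smult = (\<lambda>c s. f (c \<odot>\<^bsub>H\<^esub> g s)), vnorm = (\<lambda>s. vnorm H (g s))\<rparr>)"

locale closed_subspace_embedding = hilbert_space K H for K and H :: "'h nspace" +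
  fixes H0 :: "'h set" and f :: "'h \<Rightarrow> 'k"
  assumes field: "K = \<real> \<or> K = UNIV"
    and sub: "H0 \<subseteq> carrier H"
    and sub0: "\<zero>\<^bsub>H\<^esub> \<in> H0"
    and sub_add: "x \<in> H0 \<Longrightarrow> y \<in> H0 \<Longrightarrow> x \<oplus>\<^bsub>H\<^esub> y \<in> H0"
    and sub_smult: "c \<in> K \<Longrightarrow> x \<in> H0 \<Longrightarrow> c \<odot>\<^bsub>H\<^esub> x \<in> H0"
    and closed: "(\<And>k. s k \<in> H0) \<Longrightarrow> l \<in> carrier H \<Longrightarrow> (\<lambda>k. vdist H (s k) l) \<longlonglongrightarrow> 0 \<Longrightarrow> l \<in> H0"
    and inj: "inj_on f H0"
begin

abbreviation "H' \<equiv> image_space f H0 H"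

lemma neg1: "-1 \<in> K" using field by auto

lemma image_simps:
  "carrier H' = f ` H0" "\<zero>\<^bsub>H'\<^esub> = f \<zero>\<^bsub>H\<^esub>"
  "x \<in> H0 \<Longrightarrow> y \<in> H0 \<Longrightarrow> f x \<oplus>\<^bsub>H'\<^esub> f y = f (x \<oplus>\<^bsub>H\<^esub> y)"
  "x \<in> H0 \<Longrightarrow> c \<odot>\<^bsub>H'\<^esub> f x = f (c \<odot>\<^bsub>H\<^esub> x)"
  "x \<in> H0 \<Longrightarrow> vnorm H' (f x) = vnorm H x"
  using inj by (simp_all add: image_space_def Let_def)

lemma in_carrier: "x \<in> H0 \<Longrightarrow> x \<in> carrier H" using sub by auto

lemma module_image: "module (scalar_field K) H'"
proof (rule moduleI)
  show "cring (scalar_field K)" by (rule scalar_field_cring[OF field])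
  show "abelian_group H'"
  proof (rule abelian_groupI)
    fix x assume "x \<in> carrier H'"
    then obtain u where u: "u \<in> H0" "x = f u" by (auto simp: image_simps)
    have "(-1) \<odot>\<^bsub>H\<^esub> u \<oplus>\<^bsub>H\<^esub> u = \<zero>\<^bsub>H\<^esub>"
      using minus_conv[of u u] neg1 in_carrier[OF u(1)] in_carrier[OF sub_smult[OF neg1 u(1)]]
      by (metis M.add.m_comm M.minus_eq M.r_neg)
    then show "\<exists>y\<in>carrier H'. y \<oplus>\<^bsub>H'\<^esub> x = \<zero>\<^bsub>H'\<^esub>"
      using u sub_smult[OF neg1 u(1)] by (auto simp: image_simps intro!: bexI[of _ "(-1) \<odot>\<^bsub>H\<^esub> u"])
  qed (auto simp: image_simps sub0 sub_add in_carrier M.a_ac)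
  have one: "1 \<in> K" using field by auto
  show "\<one>\<^bsub>scalar_field K\<^esub> \<odot>\<^bsub>H'\<^esub> x = x" if "x \<in> carrier H'" for x
    using that smult_one by (auto simp: image_simps in_carrier)
qed (use smult_l_distr smult_r_distr smult_assoc1 field in
      \<open>auto simp: image_simps sub_smult sub_add in_carrier scalar_field_def\<close>)

lemma normed_image: "normed_space K H'"
  by (intro normed_space.intro module_image normed_space_axioms.intro)
     (auto simp: image_simps sub0 sub_smult sub_add in_carrier vnorm_nonneg vnorm_eq_0_iff
        vnorm_smult vnorm_triangle inj_on_eq_iff[OF inj])

lemma vdist_image: "x \<in> H0 \<Longrightarrow> y \<in> H0 \<Longrightarrow> vdist H' (f x) (f y) = vdist H x y"
  using normed_space.minus_conv[OF normed_image, of "f x" "f y"] minus_conv[of x y] neg1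
  by (simp add: vdist_def image_simps sub_smult sub_add in_carrier)

lemma hilbert_image: "hilbert_space K H'"
proof (intro hilbert_space.intro banach_space.intro normed_image
    banach_space_axioms.intro hilbert_space_axioms.intro)
  fix s assume s: "vCauchy H' s"
  define t where "t k = inv_into H0 f (s k)" for k
  have t: "t k \<in> H0" "s k = f (t k)" for k
    using s by (auto simp: vCauchy_def image_simps t_def inv_into_into f_inv_into_f)
  have "vCauchy H t"
    using s by (auto simp: vCauchy_def t vdist_image in_carrier)
  then obtain l where l: "l \<in> carrier H" "(\<lambda>k. vdist H (t k) l) \<longlonglongrightarrow> 0"
    using complete by blast
  have "l \<in> H0" using closed[of t l] t l by auto
  then show "\<exists>l\<in>carrier H'. (\<lambda>k. vdist H' (s k) l) \<longlonglongrightarrow> 0"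
    using l by (auto simp: image_simps t vdist_image intro!: bexI[of _ l])
next
  obtain ip where ip: "inner_product K H ip"
      "\<forall>x\<in>carrier H. ip x x = complex_of_real ((vnorm H x)\<^sup>2)"
    using norm_from_inner by auto
  have "inner_product K H' (\<lambda>s t. ip (inv_into H0 f s) (inv_into H0 f t))"
    unfolding inner_product_def
  proof (intro conjI ballI)
    fix x y assume "x \<in> carrier H'" "y \<in> carrier H'"
    then obtain u v where uv: "x = f u" "y = f v" "u \<in> H0" "v \<in> H0" by (auto simp: image_simps)
    have "ip u v \<in> K" using ip(1) uv in_carrier unfolding inner_product_def by blast
    then show "ip (inv_into H0 f x) (inv_into H0 f y) \<in> K"
      using uv inj by simp
    have "ip v u = cnj (ip u v)" using ip(1) uv in_carrier unfolding inner_product_def by blast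
    then show "ip (inv_into H0 f y) (inv_into H0 f x) = cnj (ip (inv_into H0 f x) (inv_into H0 f y))"
      using uv inj by simp
  next
    fix c x y assume "c \<in> K" "x \<in> carrier H'" "y \<in> carrier H'"
    then obtain u v where uv: "x = f u" "y = f v" "u \<in> H0" "v \<in> H0" by (auto simp: image_simps)
    from \<open>c \<in> K\<close> have "ip (c \<odot>\<^bsub>H\<^esub> u) v = c * ip u v"
      using ip(1) uv in_carrier unfolding inner_product_def by blast
    then show "ip (inv_into H0 f (c \<odot>\<^bsub>H'\<^esub> x)) (inv_into H0 f y)
        = c * ip (inv_into H0 f x) (inv_into H0 f y)"
      using uv inj \<open>c \<in> K\<close> by (simp add: image_simps sub_smult)
  next
    fix x y z assume "x \<in> carrier H'" "y \<in> carrier H'" "z \<in> carrier H'"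
    then obtain u v w where uv: "x = f u" "y = f v" "z = f w" "u \<in> H0" "v \<in> H0" "w \<in> H0"
      by (auto simp: image_simps)
    have "ip (u \<oplus>\<^bsub>H\<^esub> v) w = ip u w + ip v w"
      using ip(1) uv in_carrier unfolding inner_product_def by blast
    then show "ip (inv_into H0 f (x \<oplus>\<^bsub>H'\<^esub> y)) (inv_into H0 f z)
        = ip (inv_into H0 f x) (inv_into H0 f z) + ip (inv_into H0 f y) (inv_into H0 f z)"
      using uv inj by (simp add: image_simps sub_add)
  qed
  then show "\<exists>ip. inner_product K H' ip \<and>
      (\<forall>x\<in>carrier H'. ip x x = complex_of_real ((vnorm H' x)\<^sup>2))"
    using ip(2) inj by (intro exI conjI) (auto simp: image_simps in_carrier)
qed

end

context normed_space
begin

definition lincomb :: "((nat \<Rightarrow> 'b) \<Rightarrow> 'a) \<Rightarrow> ((nat \<Rightarrow> 'b) \<Rightarrow> complex) \<Rightarrow> 'a" where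
  "lincomb A u = (\<Oplus>\<^bsub>V\<^esub>x\<in>{x. u x \<noteq> 0}. u x \<odot>\<^bsub>V\<^esub> A x)"

lemma vdist_triangle:
  assumes "-1 \<in> K" "x \<in> carrier V" "y \<in> carrier V" "z \<in> carrier V"
  shows "vdist V x z \<le> vdist V x y + vdist V y z"
proof -
  have "x \<ominus>\<^bsub>V\<^esub> z = (x \<ominus>\<^bsub>V\<^esub> y) \<oplus>\<^bsub>V\<^esub> (y \<ominus>\<^bsub>V\<^esub> z)"
    using assms(2-) by (simp add: a_minus_def M.a_assoc M.r_neg1)
  then show ?thesis
    using vnorm_triangle[of "x \<ominus>\<^bsub>V\<^esub> y" "y \<ominus>\<^bsub>V\<^esub> z"] assms by (simp add: vdist_def)
qed

lemma vdist_commute: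
  assumes "-1 \<in> K" "x \<in> carrier V" "y \<in> carrier V"
  shows "vdist V x y = vdist V y x"
proof -
  have "x \<ominus>\<^bsub>V\<^esub> y = \<ominus>\<^bsub>V\<^esub> (y \<ominus>\<^bsub>V\<^esub> x)"
    using assms by (simp add: a_minus_def M.minus_add M.a_comm)
  also have "\<dots> = (-1) \<odot>\<^bsub>V\<^esub> (y \<ominus>\<^bsub>V\<^esub> x)"
    using minus_conv[of "\<zero>\<^bsub>V\<^esub>" "y \<ominus>\<^bsub>V\<^esub> x"] assms smult_closed[of "-1" "y \<ominus>\<^bsub>V\<^esub> x"]
    by (simp add: scalar_field_def a_minus_def)
  finally show ?thesis using vnorm_smult[of "-1" "y \<ominus>\<^bsub>V\<^esub> x"] assms by (simp add: vdist_def)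
qed

lemma vdist_nonneg: "x \<in> carrier V \<Longrightarrow> y \<in> carrier V \<Longrightarrow> 0 \<le> vdist V x y"
  by (simp add: vdist_def vnorm_nonneg)

lemma vdist_eq_0:
  assumes "x \<in> carrier V" "y \<in> carrier V" "vdist V x y = 0"
  shows "x = y"
  proof -
  have "x \<ominus>\<^bsub>V\<^esub> y = \<zero>\<^bsub>V\<^esub>" using assms by (simp add: vdist_def vnorm_eq_0_iff)
  then show ?thesis using assms M.minus_equality[of x "\<ominus>\<^bsub>V\<^esub> y"] by (simp add: a_minus_def)
qed

lemma vdist_add:
  assumes "x \<in> carrier V" "y \<in> carrier V" "z \<in> carrier V" "w \<in> carrier V"
  shows "vdist V (x \<oplus>\<^bsub>V\<^esub> y) (z \<oplus>\<^bsub>V\<^esub> w) \<le> vdist V x z + vdist V y w"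
proof -
  have "(x \<oplus>\<^bsub>V\<^esub> y) \<ominus>\<^bsub>V\<^esub> (z \<oplus>\<^bsub>V\<^esub> w) = (x \<ominus>\<^bsub>V\<^esub> z) \<oplus>\<^bsub>V\<^esub> (y \<ominus>\<^bsub>V\<^esub> w)"
    using assms by (simp add: a_minus_def M.minus_add M.a_ac)
  then show ?thesis
    using vnorm_triangle[of "x \<ominus>\<^bsub>V\<^esub> z" "y \<ominus>\<^bsub>V\<^esub> w"] assms by (simp add: vdist_def)
qed

lemma vdist_smult:
  assumes "c \<in> K" "x \<in> carrier V" "y \<in> carrier V"
  shows "vdist V (c \<odot>\<^bsub>V\<^esub> x) (c \<odot>\<^bsub>V\<^esub> y) = cmod c * vdist V x y"
proof -
  have "c \<odot>\<^bsub>V\<^esub> x \<ominus>\<^bsub>V\<^esub> c \<odot>\<^bsub>V\<^esub> y = c \<odot>\<^bsub>V\<^esub> (x \<ominus>\<^bsub>V\<^esub> y)"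
    using assms smult_r_distr[of c x "\<ominus>\<^bsub>V\<^esub> y"] smult_r_minus[of c y]
    by (simp add: a_minus_def scalar_field_def)
  then show ?thesis using assms by (simp add: vdist_def vnorm_smult)
qed

lemma lincomb_superset:
  assumes "A \<in> tuples n X \<rightarrow> carrier V" "u \<in> formal_sums K n X"
    "finite S" "{x. u x \<noteq> 0} \<subseteq> S" "S \<subseteq> tuples n X"
  shows "lincomb A u = (\<Oplus>\<^bsub>V\<^esub>x\<in>S. u x \<odot>\<^bsub>V\<^esub> A x)"
proof -
  have K: "u x \<in> K" for x using assms(2) by (auto simp: formal_sums_def)
  have Ac: "A x \<in> carrier V" if "x \<in> S" for x using that assms by blast
  have mem: "u x \<odot>\<^bsub>V\<^esub> A x \<in> carrier V" if "x \<in> S" for x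
    using smult_closed[of "u x" "A x"] K[of x] Ac[OF that] by (auto simp: scalar_field_def)
  have zero: "u x \<odot>\<^bsub>V\<^esub> A x = \<zero>\<^bsub>V\<^esub>" if "x \<in> S - {x. u x \<noteq> 0}" for x
    using smult_l_null[of "A x"] Ac[of x] that by (auto simp: scalar_field_def)
  show ?thesis unfolding lincomb_def
    using assms(3,4) mem zero by (intro M.add.finprod_mono_neutral_cong_left) auto
qed

lemma lincomb_closed:
  assumes "A \<in> tuples n X \<rightarrow> carrier V" "u \<in> formal_sums K n X"
  shows "lincomb A u \<in> carrier V"
  unfolding lincomb_def
proof (rule M.finsum_closed, rule Pi_I)
  fix x assume "x \<in> {x. u x \<noteq> 0}"
  then have "A x \<in> carrier V" "u x \<in> K" using assms by (auto simp: formal_sums_def)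
  then show "u x \<odot>\<^bsub>V\<^esub> A x \<in> carrier V"
    using smult_closed[of "u x" "A x"] by (simp add: scalar_field_def)
qed

lemma lincomb_add:
  assumes A: "A \<in> tuples n X \<rightarrow> carrier V" and u: "u \<in> formal_sums K n X"
    and v: "v \<in> formal_sums K n X" and K: "K = \<real> \<or> K = UNIV"
  shows "(\<lambda>x. u x + v x) \<in> formal_sums K n X"
    and "lincomb A (\<lambda>x. u x + v x) = lincomb A u \<oplus>\<^bsub>V\<^esub> lincomb A v"
proof -
  let ?S = "{x. u x \<noteq> 0} \<union> {x. v x \<noteq> 0}"
  have S: "finite ?S" "?S \<subseteq> tuples n X" using u v by (auto simp: formal_sums_def)
  have uK: "u x \<in> K" "v x \<in> K" for x using u v by (auto simp: formal_sums_def)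
  show w: "(\<lambda>x. u x + v x) \<in> formal_sums K n X"
  proof -
    have "{x. u x + v x \<noteq> 0} \<subseteq> ?S" by auto
    moreover have "u x + v x \<in> K" for x using uK K by auto
    ultimately show ?thesis
      using S finite_subset[OF _ S(1)] unfolding formal_sums_def by blast
  qed
  have mem: "c \<odot>\<^bsub>V\<^esub> A x \<in> carrier V" if "c \<in> K" "x \<in> tuples n X" for c x
    using smult_closed[of c "A x"] that A by (auto simp: scalar_field_def)
  have "lincomb A (\<lambda>x. u x + v x) = (\<Oplus>\<^bsub>V\<^esub>x\<in>?S. (u x + v x) \<odot>\<^bsub>V\<^esub> A x)"
    by (rule lincomb_superset[OF A w S(1) _ S(2)]) auto
  also have "\<dots> = (\<Oplus>\<^bsub>V\<^esub>x\<in>?S. u x \<odot>\<^bsub>V\<^esub> A x \<oplus>\<^bsub>V\<^esub> v x \<odot>\<^bsub>V\<^esub> A x)"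
  proof (rule M.finsum_cong'[OF refl])
    show "(\<lambda>x. u x \<odot>\<^bsub>V\<^esub> A x \<oplus>\<^bsub>V\<^esub> v x \<odot>\<^bsub>V\<^esub> A x) \<in> ?S \<rightarrow> carrier V"
      using mem uK S by (intro Pi_I M.a_closed) blast+
    fix x assume "x \<in> ?S"
    then have "A x \<in> carrier V" using A S by blast
    then show "(u x + v x) \<odot>\<^bsub>V\<^esub> A x = u x \<odot>\<^bsub>V\<^esub> A x \<oplus>\<^bsub>V\<^esub> v x \<odot>\<^bsub>V\<^esub> A x"
      using smult_l_distr[of "u x" "v x" "A x"] uK[of x] by (simp add: scalar_field_def)
  qed
  also have "\<dots> = (\<Oplus>\<^bsub>V\<^esub>x\<in>?S. u x \<odot>\<^bsub>V\<^esub> A x) \<oplus>\<^bsub>V\<^esub> (\<Oplus>\<^bsub>V\<^esub>x\<in>?S. v x \<odot>\<^bsub>V\<^esub> A x)"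
    using mem uK S by (intro M.finsum_addf Pi_I) blast+
  also have "\<dots> = lincomb A u \<oplus>\<^bsub>V\<^esub> lincomb A v"
    using lincomb_superset[OF A u S(1) _ S(2)] lincomb_superset[OF A v S(1) _ S(2)] by auto
  finally show "lincomb A (\<lambda>x. u x + v x) = lincomb A u \<oplus>\<^bsub>V\<^esub> lincomb A v" .
qed

lemma lincomb_smult:
  assumes A: "A \<in> tuples n X \<rightarrow> carrier V" and u: "u \<in> formal_sums K n X"
    and c: "c \<in> K" and K: "K = \<real> \<or> K = UNIV"
  shows "(\<lambda>x. c * u x) \<in> formal_sums K n X"
    and "lincomb A (\<lambda>x. c * u x) = c \<odot>\<^bsub>V\<^esub> lincomb A u"
proof -
  let ?S = "{x. u x \<noteq> 0}"
  have S: "finite ?S" "?S \<subseteq> tuples n X" using u by (auto simp: formal_sums_def)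
  have uK: "u x \<in> K" for x using u by (auto simp: formal_sums_def)
  show w: "(\<lambda>x. c * u x) \<in> formal_sums K n X"
    using S uK K c by (auto simp: formal_sums_def intro: finite_subset[OF _ S(1)])
  have mem: "c \<odot>\<^bsub>V\<^esub> A x \<in> carrier V" if "c \<in> K" "x \<in> tuples n X" for c x
    using smult_closed[of c "A x"] that A by (auto simp: scalar_field_def)
  have "lincomb A (\<lambda>x. c * u x) = (\<Oplus>\<^bsub>V\<^esub>x\<in>?S. (c * u x) \<odot>\<^bsub>V\<^esub> A x)"
    by (rule lincomb_superset[OF A w S(1) _ S(2)]) auto
  also have "\<dots> = (\<Oplus>\<^bsub>V\<^esub>x\<in>?S. c \<odot>\<^bsub>V\<^esub> (u x \<odot>\<^bsub>V\<^esub> A x))"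
  proof (rule M.finsum_cong'[OF refl])
    have "u x \<odot>\<^bsub>V\<^esub> A x \<in> carrier V" if "x \<in> ?S" for x using mem[OF uK[of x]] that S by blast
    then show "(\<lambda>x. c \<odot>\<^bsub>V\<^esub> (u x \<odot>\<^bsub>V\<^esub> A x)) \<in> ?S \<rightarrow> carrier V"
      using c smult_closed[of c] by (auto simp: scalar_field_def)
    fix x assume "x \<in> ?S"
    then have "A x \<in> carrier V" using A S by blast
    then show "(c * u x) \<odot>\<^bsub>V\<^esub> A x = c \<odot>\<^bsub>V\<^esub> (u x \<odot>\<^bsub>V\<^esub> A x)"
      using smult_assoc1[of c "u x" "A x"] uK[of x] c by (simp add: scalar_field_def)
  qed
  also have "\<dots> = c \<odot>\<^bsub>V\<^esub> (\<Oplus>\<^bsub>V\<^esub>x\<in>?S. u x \<odot>\<^bsub>V\<^esub> A x)"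
    using S mem uK c by (intro finsum_smult_ldistr[symmetric] Pi_I) (auto simp: scalar_field_def)
  finally show "lincomb A (\<lambda>x. c * u x) = c \<odot>\<^bsub>V\<^esub> lincomb A u" by (simp add: lincomb_def)
qed

lemma lincomb_single:
  assumes A: "A \<in> tuples n X \<rightarrow> carrier V" and x: "x \<in> tuples n X" and K: "K = \<real> \<or> K = UNIV"
  shows "single x \<in> formal_sums K n X" and "lincomb A (single x) = A x"
proof -
  show s: "single x \<in> formal_sums K n X" using x K by (auto simp: formal_sums_def single_def)
  have "A x \<in> carrier V" using A x by auto
  then show "lincomb A (single x) = A x"
    using smult_one[of "A x"] lincomb_superset[OF A s, of "{x}"] x
    by (auto simp: single_def scalar_field_def)
qed

end

lemma hilbert_factorization_universal:
  fixes H :: "'h nspace" and X :: "nat \<Rightarrow> 'a nspace"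
  assumes K: "K = \<real> \<or> K = UNIV" and fact: "hilbert_factorization K n X Y T H M A B"
  shows "\<exists>(H' :: 'a hvec nspace) M' A' B'. hilbert_factorization K n X Y T H' M' A' B' \<and>
           mnorm n X H' A' = mnorm n X H A \<and> Lip H' Y M' B' \<le> Lip H Y M B"
proof -
  interpret hilbert_space K H using fact by (simp add: hilbert_factorization_def)
  have M: "M \<subseteq> carrier H" "A ` tuples n X \<subseteq> M" and bm: "bounded_multilinear K n X H A"
    and B: "B \<in> M \<rightarrow> carrier Y" "lip_consts H Y M B \<noteq> {}" and T: "\<forall>x\<in>tuples n X. T x = B (A x)"
    using fact by (auto simp: hilbert_factorization_def)
  have A: "A \<in> tuples n X \<rightarrow> carrier H" using M by auto
  have neg1: "-1 \<in> K" using K by auto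
  let ?F = "formal_sums K n X"
  define appr where "appr h s \<longleftrightarrow> (\<forall>k. s k \<in> ?F) \<and> (\<lambda>k. vdist H (lincomb A (s k)) h) \<longlonglongrightarrow> 0" for h s
  define H0 where "H0 = {h \<in> carrier H. \<exists>s. appr h s}"
  define f where "f h = (SOME s. appr h s)" for h
  have f: "appr h (f h)" if "h \<in> H0" for h
    proof -
    have "\<exists>s. appr h s" using that by (simp add: H0_def)
    then show ?thesis unfolding f_def by (rule someI_ex)
  qed
  have near: "h \<in> H0" if h: "h \<in> carrier H"
    and ex: "\<And>e. e > 0 \<Longrightarrow> \<exists>u\<in>?F. vdist H (lincomb A u) h < e" for h
  proof -
    have "\<exists>u\<in>?F. vdist H (lincomb A u) h < inverse (real (Suc k))" for k by (rule ex) simp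
    then have "\<exists>s. \<forall>k. s k \<in> ?F \<and> vdist H (lincomb A (s k)) h < inverse (real (Suc k))"
      by (intro choice) auto
    then obtain s where s: "s k \<in> ?F" "vdist H (lincomb A (s k)) h < inverse (real (Suc k))" for k
      by auto
    have "(\<lambda>k. vdist H (lincomb A (s k)) h) \<longlonglongrightarrow> 0"
    proof (rule tendsto_sandwich[OF _ _ tendsto_const LIMSEQ_inverse_real_of_nat])
      show "\<forall>\<^sub>F k in sequentially. 0 \<le> vdist H (lincomb A (s k)) h"
        using vdist_nonneg lincomb_closed[OF A s(1)] h by simp
      show "\<forall>\<^sub>F k in sequentially. vdist H (lincomb A (s k)) h \<le> inverse (real (Suc k))"
        using less_imp_le[OF s(2)] by (intro always_eventually allI)
    qed
    then show ?thesis using s h by (auto simp: H0_def appr_def)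
  qed
  have H0D: "h \<in> carrier H" "\<exists>u\<in>?F. vdist H (lincomb A u) h < e" if "h \<in> H0" "e > 0" for h e
  proof -
    show "h \<in> carrier H" using that by (simp add: H0_def)
    have "eventually (\<lambda>k. vdist H (lincomb A (f h k)) h < e) sequentially"
      using f[OF that(1)] that(2) by (auto simp: appr_def dest: order_tendstoD(2))
    then show "\<exists>u\<in>?F. vdist H (lincomb A u) h < e"
      using f[OF that(1)] by (auto simp: appr_def eventually_sequentially)
  qed
  have H0c: "h \<in> carrier H" if "h \<in> H0" for h using that by (simp add: H0_def)
  have AH0: "A x \<in> H0" if x: "x \<in> tuples n X" for x
  proof (rule near)
    show c: "A x \<in> carrier H" using A x by auto
    fix e :: real assume "e > 0"
    moreover have "vdist H (A x) (A x) = 0" using c vnorm_eq_0_iff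
      by (simp add: vdist_def a_minus_def M.r_neg)
    ultimately show "\<exists>u\<in>?F. vdist H (lincomb A u) (A x) < e"
      using lincomb_single[OF A x K] by (intro bexI[of _ "single x"]) auto
  qed
  interpret E: closed_subspace_embedding K H H0 f
  proof unfold_locales
    show "K = \<real> \<or> K = UNIV" by (rule K)
    show "H0 \<subseteq> carrier H" by (auto simp: H0_def)
    show "\<zero>\<^bsub>H\<^esub> \<in> H0"
    proof (rule near)
      fix e :: real assume "e > 0"
      moreover have "lincomb A (\<lambda>z. 0) = \<zero>\<^bsub>H\<^esub>" by (simp add: lincomb_def)
      moreover have "vdist H \<zero>\<^bsub>H\<^esub> \<zero>\<^bsub>H\<^esub> = 0" using vnorm_eq_0_iff by (simp add: vdist_def a_minus_def)
      moreover have "(\<lambda>z. 0) \<in> ?F" using K by (auto simp: formal_sums_def)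
      ultimately show "\<exists>u\<in>?F. vdist H (lincomb A u) \<zero>\<^bsub>H\<^esub> < e" by (intro bexI[of _ "\<lambda>z. 0"]) auto
    qed simp
    show "x \<oplus>\<^bsub>H\<^esub> y \<in> H0" if xy: "x \<in> H0" "y \<in> H0" for x y
    proof (rule near)
      show "x \<oplus>\<^bsub>H\<^esub> y \<in> carrier H" using xy by (simp add: H0c)
      fix e :: real assume "e > 0"
      then obtain u v where uv: "u \<in> ?F" "vdist H (lincomb A u) x < e/2"
          "v \<in> ?F" "vdist H (lincomb A v) y < e/2"
        using H0D(2)[OF xy(1), of "e/2"] H0D(2)[OF xy(2), of "e/2"] by auto
      then show "\<exists>u\<in>?F. vdist H (lincomb A u) (x \<oplus>\<^bsub>H\<^esub> y) < e"
        using vdist_add[of "lincomb A u" "lincomb A v" x y] lincomb_add[OF A uv(1,3) K]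
          lincomb_closed[OF A] H0c xy
        by (intro bexI[of _ "\<lambda>x. u x + v x"]) auto
    qed
    show "c \<odot>\<^bsub>H\<^esub> x \<in> H0" if c: "c \<in> K" and x: "x \<in> H0" for c x
    proof (rule near)
      show "c \<odot>\<^bsub>H\<^esub> x \<in> carrier H" using c H0c[OF x] smult_closed[of c x] by (simp add: scalar_field_def)
      fix e :: real assume e: "e > 0"
      define d where "d = e / (cmod c + 1)"
      have c1: "cmod c + 1 > 0" using norm_ge_zero[of c] by linarith
      then have d: "d > 0" using e by (simp add: d_def)
      then obtain u where u: "u \<in> ?F" "vdist H (lincomb A u) x < d" using H0D(2)[OF x] by blast
      have "cmod c * vdist H (lincomb A u) x \<le> cmod c * d"
        using u by (intro mult_left_mono) auto
      also have "\<dots> < (cmod c + 1) * d" using d by (simp add: algebra_simps)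
      also have "\<dots> = e" using c1 by (simp add: d_def)
      finally show "\<exists>u\<in>?F. vdist H (lincomb A u) (c \<odot>\<^bsub>H\<^esub> x) < e"
        using lincomb_smult[OF A u(1) c K] vdist_smult[OF c lincomb_closed[OF A u(1)] H0c[OF x]]
        by (intro bexI[of _ "\<lambda>x. c * u x"]) auto
    qed
    show "l \<in> H0" if s: "\<And>k. s k \<in> H0" and l: "l \<in> carrier H"
      and lim: "(\<lambda>k. vdist H (s k) l) \<longlonglongrightarrow> 0" for s l
    proof (rule near[OF l])
      fix e :: real assume e: "e > 0"
      have "eventually (\<lambda>k. vdist H (s k) l < e/2) sequentially"
        using order_tendstoD(2)[OF lim, of "e/2"] e by simp
      then obtain k where k: "vdist H (s k) l < e/2" by (auto simp: eventually_sequentially)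
      obtain u where u: "u \<in> ?F" "vdist H (lincomb A u) (s k) < e/2"
        using H0D(2)[OF s, of "e/2" k] e by auto
      show "\<exists>u\<in>?F. vdist H (lincomb A u) l < e"
        using u k vdist_triangle[OF neg1 lincomb_closed[OF A u(1)] H0c[OF s[of k]] l]
        by (intro bexI[of _ u]) auto
    qed
    show "inj_on f H0"
    proof (rule inj_onI)
      fix x y assume xy: "x \<in> H0" "y \<in> H0" "f x = f y"
      let ?s = "\<lambda>k. lincomb A (f x k)"
      have c: "?s k \<in> carrier H" for k using f[OF xy(1)] lincomb_closed[OF A] by (simp add: appr_def)
      have lx: "(\<lambda>k. vdist H (?s k) x) \<longlonglongrightarrow> 0" and ly: "(\<lambda>k. vdist H (?s k) y) \<longlonglongrightarrow> 0"
        using f[OF xy(1)] f[OF xy(2)] xy(3) by (auto simp: appr_def)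
      have le: "vdist H x y \<le> vdist H (?s k) x + vdist H (?s k) y" for k
        using vdist_triangle[OF neg1 H0c[OF xy(1)] c H0c[OF xy(2)]]
          vdist_commute[OF neg1 H0c[OF xy(1)] c] by simp
      have "vdist H x y \<le> 0 + 0"
        by (rule LIMSEQ_le_const[OF tendsto_add[OF lx ly]]) (use le in blast)
      then have "vdist H x y = 0"
        using vdist_nonneg[OF H0c[OF xy(1)] H0c[OF xy(2)]] by linarith
      then show "x = y"
        by (rule vdist_eq_0[OF H0c[OF xy(1)] H0c[OF xy(2)]])
    qed
  qed
  let ?A = "\<lambda>x. f (A x)" and ?M = "f ` A ` tuples n X" and ?B = "\<lambda>h. B (inv_into H0 f h)"
  have inv: "inv_into H0 f (f (A x)) = A x" if "x \<in> tuples n X" for x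
    using E.inj AH0[OF that] by simp
  have norm: "vnorm E.H' (?A x) = vnorm H (A x)" if "x \<in> tuples n X" for x
    using AH0[OF that] by (simp add: E.image_simps)
  have up: "x(i := a) \<in> tuples n X" if "x \<in> tuples n X" "i \<in> {1..n}" "a \<in> carrier (X i)" for x i a
    using that by (auto simp: tuples_def PiE_iff extensional_def)
  have "multilinear K n X E.H' ?A"
  proof -
    have "?A \<in> tuples n X \<rightarrow> carrier E.H'" using AH0 by (auto simp: E.image_simps)
    then show ?thesis
      using bm unfolding multilinear_def bounded_multilinear_def
      by (simp add: E.image_simps AH0 up)
  qed
  moreover have ball: "(\<lambda>x. vnorm E.H' (?A x)) ` unit_tuples n X = (\<lambda>x. vnorm H (A x)) ` unit_tuples n X"
    using norm by (intro image_cong) (auto simp: unit_tuples_def)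
  ultimately have bm': "bounded_multilinear K n X E.H' ?A"
    using bm by (simp add: bounded_multilinear_def)
  have lip: "lip_consts H Y M B \<subseteq> lip_consts E.H' Y ?M ?B"
    using M(2) AH0 inv by (auto simp: lip_consts_def E.vdist_image image_subset_iff)
  have "B (A x) \<in> carrier Y" if "x \<in> tuples n X" for x using B(1) M(2) that by blast
  then have "hilbert_factorization K n X Y T E.H' ?M ?A ?B"
    unfolding hilbert_factorization_def
    using E.hilbert_image bm' B M AH0 T lip inv by (auto simp: E.image_simps)
  moreover have "mnorm n X E.H' ?A = mnorm n X H A" using ball by (simp add: mnorm_def)
  moreover have "Lip E.H' Y ?M ?B \<le> Lip H Y M B"
    unfolding Lip_def
  proof (rule cInf_superset_mono[OF B(2) _ lip])
    show "bdd_below (lip_consts E.H' Y ?M ?B)"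
      by (rule bdd_belowI[of _ 0]) (simp add: lip_consts_def)
  qed
  ultimately show ?thesis by (intro exI conjI)
qed

end

theory Submission
  imports Defs
begin

text \<open>
  On the range of \<open>A\<close> the map \<open>B\<close> of a factorization \<open>T = B \<circ> A\<close> is determined by \<open>T\<close>, so a
  factorization of cost at most \<open>a L\<close> is the same as a multilinear \<open>A\<close> into a Hilbert space with
  \<open>\<parallel>A\<parallel> \<le> a\<close> and \<open>\<parallel>T x - T y\<parallel> \<le> L \<parallel>A x - A y\<parallel>\<close>. Rescaling \<open>A\<close> makes \<open>a = L\<close>; then the direct
  sum of two such \<open>A\<close> and the Cauchy-Schwarz inequality in the plane give the triangle inequality
  for \<open>\<Gamma>\<close>. The lower bound \<open>\<parallel>T\<parallel> \<le> \<Gamma>(T)\<close> comes from \<open>T 0 = 0\<close> and makes \<open>\<Gamma>\<close> definite, and a rank-one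
  operator factors through the scalar field. For the composition with \<open>R\<close>, the linearization of
  \<open>A\<close> is bounded for the projective norm, so \<open>A\<close> can be pulled back along \<open>R\<close>. The pullback
  involves only decomposable tensors, that is, constant Cauchy sequences, so no extension of a map
  to the completion is needed.
\<close>

text \<open>\<open>Gamma_norm\<close> admits only Hilbert spaces with vectors of type
  \<open>'a hvec\<close>, built on the vectors of the factors, yet the constructions leave that
  type: the direct sum consists of pairs, the rank-one case uses the scalar field, and composition
  with \<open>R\<close> keeps a Hilbert space made for the \<open>X i\<close> while the new factors
  are the \<open>Z j\<close>. Domination of distances is therefore stated for every vector type, and
  the closed-span argument of \<open>hilbert_factorization_universal\<close> returns to the
  prescribed type at a single place.

  The infimum defining \<Gamma> need not be attained. Each upper estimate is proved for every
  \<open>g\<close> above \<Gamma>(T), where a factorization of cost less than \<open>g\<close>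
  exists, and \<open>g\<close> is then lowered.

  In the completed tensor product, equality of two embedded tensors yields only that their
  projective distance is zero. A linearization f satisfies |f(u)| \<le> a |u| for the projective
  norm, so distance zero already forces equal values; this gives the well-definedness of f_T and the
  additivity of f_A along \<open>R\<close>.\<close>

lemma scalar_field_simps [simp]:
  "carrier (scalar_field K) = K" "\<zero>\<^bsub>scalar_field K\<^esub> = 0" "\<one>\<^bsub>scalar_field K\<^esub> = 1"
  "x \<oplus>\<^bsub>scalar_field K\<^esub> y = x + y" "x \<otimes>\<^bsub>scalar_field K\<^esub> y = x * y"
  "c \<odot>\<^bsub>scalar_field K\<^esub> x = c * x" "vnorm (scalar_field K) x = cmod x"
  by (simp_all add: scalar_field_def)

section \<open>Scalars and distances in a normed space\<close>

context normed_space
begin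

lemmas scale_closed [simp] = smult_closed[unfolded scalar_field_simps]
  and scale_left_distrib = smult_l_distr[unfolded scalar_field_simps]
  and scale_right_distrib = smult_r_distr[unfolded scalar_field_simps]
  and scale_scale = smult_assoc1[unfolded scalar_field_simps, symmetric]
  and scale_one [simp] = smult_one[unfolded scalar_field_simps]
  and scale_zero_left [simp] = smult_l_null[unfolded scalar_field_simps]
  and scale_zero_right [simp] = smult_r_null[unfolded scalar_field_simps]

lemma scalar_closed:
  assumes "c \<in> K" "d \<in> K"
  shows "c + d \<in> K" "c * d \<in> K"
  using R.a_closed[of c d] R.m_closed[of c d] assms by simp_all

text \<open>The locale knows \<open>K\<close> only as a ring under the complex operations; the
  additive inverse of the unit in that ring sums with 1 to the complex number 0 and is therefore
  \<open>- 1\<close>.\<close>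

lemma neg_one_mem: "- 1 \<in> K"
proof -
  note neg = R.a_inv_closed[OF R.one_closed] R.l_neg[OF R.one_closed]
  then have "\<ominus>\<^bsub>scalar_field K\<^esub> \<one>\<^bsub>scalar_field K\<^esub> = - 1"
    unfolding scalar_field_simps by (simp only: eq_neg_iff_add_eq_0)
  then show ?thesis using neg(1) unfolding scalar_field_simps by (simp only:)
qed

lemma one_mem: "1 \<in> K"
  using R.one_closed by simp

lemma minus_eq_scale: "x \<in> carrier V \<Longrightarrow> y \<in> carrier V \<Longrightarrow> x \<ominus>\<^bsub>V\<^esub> y = x \<oplus>\<^bsub>V\<^esub> ((- 1) \<odot>\<^bsub>V\<^esub> y)"
  using minus_conv neg_one_mem by simp

lemma scale_commute:
  assumes "c \<in> K" "d \<in> K" "x \<in> carrier V"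
  shows "c \<odot>\<^bsub>V\<^esub> (d \<odot>\<^bsub>V\<^esub> x) = d \<odot>\<^bsub>V\<^esub> (c \<odot>\<^bsub>V\<^esub> x)"
  using scale_scale[OF assms] scale_scale[OF assms(2,1,3)] by (simp add: mult.commute)

lemma vnorm_zero [simp]: "vnorm V \<zero>\<^bsub>V\<^esub> = 0"
  by (simp add: vnorm_eq_0_iff)

lemma vdist_self [simp]: "x \<in> carrier V \<Longrightarrow> vdist V x x = 0"
  by (simp add: vdist_def a_minus_def M.r_neg)

lemma vdist_zero_right: "x \<in> carrier V \<Longrightarrow> vdist V x \<zero>\<^bsub>V\<^esub> = vnorm V x"
  by (simp add: vdist_def a_minus_def M.minus_equality[of "\<zero>\<^bsub>V\<^esub>" "\<zero>\<^bsub>V\<^esub>"])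

lemma vnorm_finsum_le:
  assumes "finite S" "f \<in> S \<rightarrow> carrier V"
  shows "vnorm V (\<Oplus>\<^bsub>V\<^esub>x\<in>S. f x) \<le> (\<Sum>x\<in>S. vnorm V (f x))"
  using assms
proof (induction S)
  case (insert x S)
  then have "vnorm V (f x \<oplus>\<^bsub>V\<^esub> (\<Oplus>\<^bsub>V\<^esub>x\<in>S. f x)) \<le> vnorm V (f x) + vnorm V (\<Oplus>\<^bsub>V\<^esub>x\<in>S. f x)"
    by (intro vnorm_triangle M.finsum_closed) auto
  moreover have "f \<in> S \<rightarrow> carrier V" "f x \<in> carrier V" using insert.prems by auto
  ultimately show ?case using insert.IH insert.hyps by (simp add: M.finsum_insert)
qed simp

text \<open>For fixed \<open>x\<close>, multiplying \<open>x\<close> by a scalar is Lipschitz in the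
  scalar with constant |x|; this map is the second factor of a rank-one operator.\<close>

lemma vdist_scale_left:
  assumes "c \<in> K" "d \<in> K" "x \<in> carrier V"
  shows "vdist V (c \<odot>\<^bsub>V\<^esub> x) (d \<odot>\<^bsub>V\<^esub> x) = cmod (c - d) * vnorm V x"
proof -
  have d: "- d \<in> K" using scalar_closed(2)[OF neg_one_mem assms(2)] by simp
  have "c \<odot>\<^bsub>V\<^esub> x \<ominus>\<^bsub>V\<^esub> d \<odot>\<^bsub>V\<^esub> x = c \<odot>\<^bsub>V\<^esub> x \<oplus>\<^bsub>V\<^esub> (- d) \<odot>\<^bsub>V\<^esub> x"
    using minus_eq_scale[of "c \<odot>\<^bsub>V\<^esub> x" "d \<odot>\<^bsub>V\<^esub> x"] scale_scale[OF neg_one_mem assms(2,3)] assms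
    by simp
  also have "\<dots> = (c - d) \<odot>\<^bsub>V\<^esub> x"
    using scale_left_distrib[OF assms(1) d assms(3)] by simp
  finally show ?thesis
    using vnorm_smult[of "c - d" x] scalar_closed(1)[OF assms(1) d] assms by (simp add: vdist_def)
qed

end

section \<open>Two Hilbert spaces\<close>

lemma normed_scalar_field:
  assumes "K = \<real> \<or> K = UNIV"
  shows "normed_space K (scalar_field K)"
proof (intro normed_space.intro normed_space_axioms.intro)
  show "module (scalar_field K) (scalar_field K)"
    using scalar_field_cring[OF assms] assms
    by (intro moduleI) (auto simp: algebra_simps cring_def ring_def)
qed (auto simp: norm_mult norm_triangle_ineq)

lemma hilbert_scalar_field:
  assumes K: "K = \<real> \<or> K = UNIV"
  shows "hilbert_space K (scalar_field K)"
proof -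
  interpret normed_space K "scalar_field K" by (rule normed_scalar_field[OF K])
  have dist: "vdist (scalar_field K) x y = dist x y" if "x \<in> K" "y \<in> K" for x y
    using minus_eq_scale[of x y] that by (simp add: vdist_def dist_norm)
  show ?thesis
  proof (unfold_locales)
    fix s assume s: "vCauchy (scalar_field K) s"
    then have sK: "s k \<in> K" for k by (simp add: vCauchy_def)
    have "Cauchy s" using s unfolding vCauchy_def Cauchy_def dist[OF sK sK] by blast
    then obtain l where l: "s \<longlonglongrightarrow> l" using Cauchy_convergent convergent_def by blast
    \<comment> \<open>The limit exists in the complex numbers. For real \<open>K\<close> it stays in
      \<open>K\<close> because its imaginary part is a limit of zeros.\<close>
    have "l \<in> K"
    proof (cases "K = UNIV")
      case False
      then have "s k \<in> \<real>" for k using sK K by auto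
      then have "(\<lambda>k. Im (s k)) = (\<lambda>k. 0)" by (simp add: complex_is_Real_iff)
      then have "Im l = 0" using tendsto_Im[OF l] LIMSEQ_unique[OF _ tendsto_const] by metis
      then show ?thesis using K False by (simp add: complex_is_Real_iff)
    qed simp
    then show "\<exists>l\<in>carrier (scalar_field K). (\<lambda>k. vdist (scalar_field K) (s k) l) \<longlonglongrightarrow> 0"
      using tendsto_dist_iff[THEN iffD1, OF l] sK by (auto simp: dist intro!: bexI[of _ l])
  next
    show "\<exists>ip. inner_product K (scalar_field K) ip \<and>
      (\<forall>x\<in>carrier (scalar_field K). ip x x = complex_of_real ((vnorm (scalar_field K) x)\<^sup>2))"
    proof (intro exI conjI)
      have "x * cnj y \<in> K" if "x \<in> K" "y \<in> K" for x y
        using K that by (auto simp: Reals_cnj_iff)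
      then show "inner_product K (scalar_field K) (\<lambda>x y. x * cnj y)"
        by (simp add: inner_product_def algebra_simps)
    qed (simp add: complex_norm_square del: of_real_power)
  qed
qed

text \<open>The Euclidean combination of the two norms is the one induced by an inner product,
  namely the sum of the two given inner products.\<close>

definition hilbert_sum :: "'g nspace \<Rightarrow> 'h nspace \<Rightarrow> ('g \<times> 'h) nspace" where
  "hilbert_sum G H =
     \<lparr>carrier = carrier G \<times> carrier H, mult = undefined, one = undefined,
      zero = (\<zero>\<^bsub>G\<^esub>, \<zero>\<^bsub>H\<^esub>),
      add = (\<lambda>p q. (fst p \<oplus>\<^bsub>G\<^esub> fst q, snd p \<oplus>\<^bsub>H\<^esub> snd q)),
      smult = (\<lambda>c p. (c \<odot>\<^bsub>G\<^esub> fst p, c \<odot>\<^bsub>H\<^esub> snd p)),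
      vnorm = (\<lambda>p. sqrt ((vnorm G (fst p))\<^sup>2 + (vnorm H (snd p))\<^sup>2))\<rparr>"

lemma hilbert_sum_simps [simp]:
  "carrier (hilbert_sum G H) = carrier G \<times> carrier H"
  "\<zero>\<^bsub>hilbert_sum G H\<^esub> = (\<zero>\<^bsub>G\<^esub>, \<zero>\<^bsub>H\<^esub>)"
  "p \<oplus>\<^bsub>hilbert_sum G H\<^esub> q = (fst p \<oplus>\<^bsub>G\<^esub> fst q, snd p \<oplus>\<^bsub>H\<^esub> snd q)"
  "c \<odot>\<^bsub>hilbert_sum G H\<^esub> p = (c \<odot>\<^bsub>G\<^esub> fst p, c \<odot>\<^bsub>H\<^esub> snd p)"
  "vnorm (hilbert_sum G H) p = sqrt ((vnorm G (fst p))\<^sup>2 + (vnorm H (snd p))\<^sup>2)"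
  by (simp_all add: hilbert_sum_def)

lemma normed_hilbert_sum:
  assumes "normed_space K G" "normed_space K H"
  shows "normed_space K (hilbert_sum G H)"
proof -
  interpret G: normed_space K G by fact
  interpret H: normed_space K H by fact
  have "abelian_group (hilbert_sum G H)"
  proof (rule abelian_groupI)
    fix p assume "p \<in> carrier (hilbert_sum G H)"
    then show "\<exists>q\<in>carrier (hilbert_sum G H). q \<oplus>\<^bsub>hilbert_sum G H\<^esub> p = \<zero>\<^bsub>hilbert_sum G H\<^esub>"
      by (intro bexI[of _ "(\<ominus>\<^bsub>G\<^esub> fst p, \<ominus>\<^bsub>H\<^esub> snd p)"]) (auto simp: G.M.l_neg H.M.l_neg)
  qed (auto simp: G.M.a_ac H.M.a_ac)
  then have "module (scalar_field K) (hilbert_sum G H)"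
    using G.R.cring_axioms
    by (intro moduleI)
       (auto simp: G.scale_left_distrib H.scale_left_distrib G.scale_right_distrib
          H.scale_right_distrib G.scale_scale H.scale_scale)
  then show ?thesis
  proof (intro normed_space.intro normed_space_axioms.intro)
    fix c p assume "c \<in> K" "p \<in> carrier (hilbert_sum G H)"
    then show "vnorm (hilbert_sum G H) (c \<odot>\<^bsub>hilbert_sum G H\<^esub> p) = cmod c * vnorm (hilbert_sum G H) p"
      by (auto simp: G.vnorm_smult H.vnorm_smult power_mult_distrib real_sqrt_mult
          distrib_left[symmetric])
  next
    fix p q assume pq: "p \<in> carrier (hilbert_sum G H)" "q \<in> carrier (hilbert_sum G H)"
    \<comment> \<open>The triangle inequalities of the components are combined by monotonicity of
      the root, followed by Minkowski's inequality in the plane.\<close>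
    have "vnorm (hilbert_sum G H) (p \<oplus>\<^bsub>hilbert_sum G H\<^esub> q)
        \<le> sqrt ((vnorm G (fst p) + vnorm G (fst q))\<^sup>2 + (vnorm H (snd p) + vnorm H (snd q))\<^sup>2)"
      using pq by (auto intro!: add_mono power_mono G.vnorm_triangle H.vnorm_triangle
          G.vnorm_nonneg H.vnorm_nonneg)
    also have "\<dots> \<le> vnorm (hilbert_sum G H) p + vnorm (hilbert_sum G H) q"
      using real_sqrt_sum_squares_triangle_ineq by simp
    finally show "vnorm (hilbert_sum G H) (p \<oplus>\<^bsub>hilbert_sum G H\<^esub> q)
      \<le> vnorm (hilbert_sum G H) p + vnorm (hilbert_sum G H) q" .
  qed (auto simp: G.vnorm_eq_0_iff H.vnorm_eq_0_iff)
qed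

text \<open>Subtraction goes through an additive inverse, which is no field of the record; rewritten
  as addition of \<open>- 1\<close> times the second vector, it can be computed by
  components.\<close>

lemma vdist_hilbert_sum:
  assumes "normed_space K G" "normed_space K H"
    and "p \<in> carrier (hilbert_sum G H)" "q \<in> carrier (hilbert_sum G H)"
  shows "vdist (hilbert_sum G H) p q
    = sqrt ((vdist G (fst p) (fst q))\<^sup>2 + (vdist H (snd p) (snd q))\<^sup>2)"
proof -
  interpret G: normed_space K G by fact
  interpret H: normed_space K H by fact
  interpret S: normed_space K "hilbert_sum G H" by (intro normed_hilbert_sum assms)
  have "p \<ominus>\<^bsub>hilbert_sum G H\<^esub> q = (fst p \<ominus>\<^bsub>G\<^esub> fst q, snd p \<ominus>\<^bsub>H\<^esub> snd q)"
    using S.minus_eq_scale[OF assms(3,4)] assms(3,4)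
    by (auto simp: G.minus_eq_scale H.minus_eq_scale)
  then show ?thesis by (simp add: vdist_def)
qed

lemma hilbert_hilbert_sum:
  assumes "hilbert_space K G" "hilbert_space K H"
  shows "hilbert_space K (hilbert_sum G H)"
proof -
  interpret G: hilbert_space K G by fact
  interpret H: hilbert_space K H by fact
  note nG = G.normed_space_axioms and nH = H.normed_space_axioms
  interpret S: normed_space K "hilbert_sum G H" by (intro normed_hilbert_sum nG nH)
  note dist = vdist_hilbert_sum[OF nG nH]
  show ?thesis
  proof (unfold_locales)
    fix s assume s: "vCauchy (hilbert_sum G H) s"
    then have sc: "s k \<in> carrier (hilbert_sum G H)" for k by (simp add: vCauchy_def)
    then have sc': "fst (s k) \<in> carrier G" "snd (s k) \<in> carrier H" for k by (auto simp: mem_Times_iff)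
    \<comment> \<open>Both projections are contractions, so the components inherit the Cauchy
      property.\<close>
    have le: "vdist G (fst (s i)) (fst (s j)) \<le> vdist (hilbert_sum G H) (s i) (s j)"
      "vdist H (snd (s i)) (snd (s j)) \<le> vdist (hilbert_sum G H) (s i) (s j)" for i j
      by (simp_all add: dist[OF sc sc])
    have "vCauchy G (\<lambda>k. fst (s k))" "vCauchy H (\<lambda>k. snd (s k))"
      using s sc' le unfolding vCauchy_def by (meson le_less_trans)+
    then obtain a b where a: "a \<in> carrier G" "(\<lambda>k. vdist G (fst (s k)) a) \<longlonglongrightarrow> 0"
      and b: "b \<in> carrier H" "(\<lambda>k. vdist H (snd (s k)) b) \<longlonglongrightarrow> 0"
      using G.complete H.complete by meson
    have "(\<lambda>k. sqrt ((vdist G (fst (s k)) a)\<^sup>2 + (vdist H (snd (s k)) b)\<^sup>2)) \<longlonglongrightarrow> sqrt (0\<^sup>2 + 0\<^sup>2)"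
      by (intro tendsto_intros a b)
    then show "\<exists>l\<in>carrier (hilbert_sum G H). (\<lambda>k. vdist (hilbert_sum G H) (s k) l) \<longlonglongrightarrow> 0"
      using a b sc by (intro bexI[of _ "(a, b)"]) (simp_all add: dist)
  next
    obtain f g where f: "inner_product K G f" "\<forall>x\<in>carrier G. f x x = complex_of_real ((vnorm G x)\<^sup>2)"
      and g: "inner_product K H g" "\<forall>x\<in>carrier H. g x x = complex_of_real ((vnorm H x)\<^sup>2)"
      using G.norm_from_inner H.norm_from_inner by meson
    note ip = f(1)[unfolded inner_product_def] g(1)[unfolded inner_product_def]
    have "inner_product K (hilbert_sum G H) (\<lambda>p q. f (fst p) (fst q) + g (snd p) (snd q))"
      unfolding inner_product_def
    proof (intro conjI ballI)
      fix p q assume "p \<in> carrier (hilbert_sum G H)" "q \<in> carrier (hilbert_sum G H)"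
      then have "fst p \<in> carrier G" "fst q \<in> carrier G" "snd p \<in> carrier H" "snd q \<in> carrier H"
        by auto
      then have "f (fst p) (fst q) \<in> K" "g (snd p) (snd q) \<in> K"
        and "f (fst q) (fst p) = cnj (f (fst p) (fst q))"
        and "g (snd q) (snd p) = cnj (g (snd p) (snd q))"
        using ip by blast+
      then show "f (fst p) (fst q) + g (snd p) (snd q) \<in> K"
        and "f (fst q) (fst p) + g (snd q) (snd p) = cnj (f (fst p) (fst q) + g (snd p) (snd q))"
        by (simp_all add: G.scalar_closed(1))
    qed (use ip[THEN conjunct2] in \<open>simp_all add: mem_Times_iff distrib_left\<close>)
    then show "\<exists>ip. inner_product K (hilbert_sum G H) ip \<and>
      (\<forall>x\<in>carrier (hilbert_sum G H). ip x x = complex_of_real ((vnorm (hilbert_sum G H) x)\<^sup>2))"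
      using f(2) g(2) by (intro exI conjI) (auto simp: G.vnorm_nonneg H.vnorm_nonneg)
  qed
qed

section \<open>Multilinear operators\<close>

lemma tuples_update [simp]:
  "x \<in> tuples n X \<Longrightarrow> i \<in> {1..n} \<Longrightarrow> a \<in> carrier (X i) \<Longrightarrow> x(i := a) \<in> tuples n X"
  by (auto simp: tuples_def PiE_iff extensional_def)

lemma tuples_component: "x \<in> tuples n X \<Longrightarrow> i \<in> {1..n} \<Longrightarrow> x i \<in> carrier (X i)"
  by (auto simp: tuples_def)

lemma unit_tuples_subset: "unit_tuples n X \<subseteq> tuples n X"
  by (auto simp: unit_tuples_def)

lemma multilinear_closed: "multilinear K n X Y T \<Longrightarrow> x \<in> tuples n X \<Longrightarrow> T x \<in> carrier Y"
  by (auto simp: multilinear_def)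

lemma multilinear_add:
  assumes "multilinear K n X Y T" "x \<in> tuples n X" "i \<in> {1..n}" "a \<in> carrier (X i)" "b \<in> carrier (X i)"
  shows "T (x(i := a \<oplus>\<^bsub>X i\<^esub> b)) = T (x(i := a)) \<oplus>\<^bsub>Y\<^esub> T (x(i := b))"
  using assms unfolding multilinear_def by blast

lemma multilinear_smult:
  assumes "multilinear K n X Y T" "x \<in> tuples n X" "i \<in> {1..n}" "c \<in> K" "a \<in> carrier (X i)"
  shows "T (x(i := c \<odot>\<^bsub>X i\<^esub> a)) = c \<odot>\<^bsub>Y\<^esub> T (x(i := a))"
  using assms unfolding multilinear_def by blast

lemma multilinear_scaled:
  assumes T: "multilinear K n X Y T" and Y: "normed_space K Y" and c: "c \<in> K"
  shows "multilinear K n X Y (\<lambda>x. c \<odot>\<^bsub>Y\<^esub> T x)"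
proof -
  interpret Y: normed_space K Y by (rule Y)
  show ?thesis
    using c T multilinear_closed[OF T] unfolding multilinear_def
    by (auto simp: Y.scale_right_distrib intro!: Y.scale_commute)
qed

lemma multilinear_sum:
  assumes S: "multilinear K n X Y S" and T: "multilinear K n X Y T" and Y: "normed_space K Y"
  shows "multilinear K n X Y (\<lambda>x. S x \<oplus>\<^bsub>Y\<^esub> T x)"
proof -
  interpret Y: normed_space K Y by (rule Y)
  show ?thesis
    using S T multilinear_closed[OF T] multilinear_closed[OF S] unfolding multilinear_def
    by (auto simp: Y.scale_right_distrib Y.M.a_ac)
qed

locale factor_spaces =
  fixes K :: "complex set" and n :: nat and X :: "nat \<Rightarrow> 'a nspace"
  assumes field: "K = \<real> \<or> K = UNIV"
    and pos: "1 \<le> n"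
    and factors: "i \<in> {1..n} \<Longrightarrow> normed_space K (X i)"
begin

lemma of_real_mem: "complex_of_real r \<in> K"
  using field by auto

lemma factors_add_closed:
  assumes "i \<in> {1..n}" "a \<in> carrier (X i)" "b \<in> carrier (X i)"
  shows "a \<oplus>\<^bsub>X i\<^esub> b \<in> carrier (X i)"
proof -
  interpret normed_space K "X i" using factors assms(1) by blast
  show ?thesis using assms by simp
qed

lemma factors_smult_closed:
  assumes "i \<in> {1..n}" "c \<in> K" "a \<in> carrier (X i)"
  shows "c \<odot>\<^bsub>X i\<^esub> a \<in> carrier (X i)"
proof -
  interpret normed_space K "X i" using factors assms(1) by blast
  show ?thesis using assms by simp
qed

text \<open>The conditions evaluate the operator at tuples only, since closure of the factors keeps
  the updated arguments among the tuples. Hence an operator may be exchanged for its extensional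
  restriction.\<close>

lemma multilinear_cong:
  assumes "multilinear K n X Y T" "\<And>x. x \<in> tuples n X \<Longrightarrow> S x = T x"
  shows "multilinear K n X Y S"
  using assms factors_add_closed factors_smult_closed unfolding multilinear_def
  by (simp add: Pi_iff)

lemma vnorm_factor_nonneg: "x \<in> tuples n X \<Longrightarrow> i \<in> {1..n} \<Longrightarrow> 0 \<le> vnorm (X i) (x i)"
  using normed_space.vnorm_nonneg[OF factors] tuples_component by blast

text \<open>It keeps the suprema over the unit ball nonempty, and as a common zero of all
  multilinear operators it is the reference point at which Lipschitz estimates become norm
  estimates.\<close>

definition zero_tuple :: "nat \<Rightarrow> 'a" where
  "zero_tuple = (\<lambda>i\<in>{1..n}. \<zero>\<^bsub>X i\<^esub>)"

lemma zero_tuple_mem: "zero_tuple \<in> unit_tuples n X"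
proof -
  have "\<zero>\<^bsub>X i\<^esub> \<in> carrier (X i)" "vnorm (X i) \<zero>\<^bsub>X i\<^esub> = 0" if "i \<in> {1..n}" for i
  proof -
    interpret normed_space K "X i" using factors that by blast
    show "\<zero>\<^bsub>X i\<^esub> \<in> carrier (X i)" "vnorm (X i) \<zero>\<^bsub>X i\<^esub> = 0" by simp_all
  qed
  then show ?thesis by (auto simp: unit_tuples_def tuples_def zero_tuple_def)
qed

context
  fixes Y :: "'b nspace" and T :: "(nat \<Rightarrow> 'a) \<Rightarrow> 'b"
  assumes Y: "normed_space K Y" and T: "multilinear K n X Y T"
begin

interpretation Y: normed_space K Y by (rule Y)

lemma multilinear_zero:
  assumes x: "x \<in> tuples n X" and i: "i \<in> {1..n}" and 0: "x i = \<zero>\<^bsub>X i\<^esub>"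
  shows "T x = \<zero>\<^bsub>Y\<^esub>"
proof -
  interpret N: normed_space K "X i" by (rule factors[OF i])
  \<comment> \<open>Homogeneity with the scalar 0 in slot \<open>i\<close>, where the zero vector
    equals 0 times itself.\<close>
  have "T (x(i := 0 \<odot>\<^bsub>X i\<^esub> \<zero>\<^bsub>X i\<^esub>)) = 0 \<odot>\<^bsub>Y\<^esub> T (x(i := \<zero>\<^bsub>X i\<^esub>))"
    using of_real_mem[of 0] by (intro multilinear_smult[OF T x i]) simp_all
  moreover have "x(i := \<zero>\<^bsub>X i\<^esub>) = x" using 0 by auto
  ultimately show ?thesis using multilinear_closed[OF T x] by simp
qed

text \<open>Homogeneity acts on one slot, so the set \<open>J\<close> of rescaled slots grows by
  induction. Both memberships belong to the claim because the next slot is rescaled at the tuple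
  obtained so far, with the scalar accumulated so far.\<close>

lemma multilinear_scale:
  assumes x: "x \<in> tuples n X" and c: "\<And>i. i \<in> {1..n} \<Longrightarrow> c i \<in> K" and "J \<subseteq> {1..n}"
  shows "(\<lambda>i. if i \<in> J then c i \<odot>\<^bsub>X i\<^esub> x i else x i) \<in> tuples n X \<and> (\<Prod>i\<in>J. c i) \<in> K \<and>
    T (\<lambda>i. if i \<in> J then c i \<odot>\<^bsub>X i\<^esub> x i else x i) = (\<Prod>i\<in>J. c i) \<odot>\<^bsub>Y\<^esub> T x"
proof -
  have "finite J" using assms(3) finite_subset by blast
  then show ?thesis using \<open>J \<subseteq> {1..n}\<close>
  proof (induction J)
    case empty
    then show ?case using x multilinear_closed[OF T x] Y.one_mem by simp
  next
    case (insert j J)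
    let ?x = "\<lambda>i. if i \<in> J then c i \<odot>\<^bsub>X i\<^esub> x i else x i"
    have j: "j \<in> {1..n}" and xj: "x j \<in> carrier (X j)"
      using insert.prems tuples_component[OF x] by auto
    have IH: "?x \<in> tuples n X" "(\<Prod>i\<in>J. c i) \<in> K" "T ?x = (\<Prod>i\<in>J. c i) \<odot>\<^bsub>Y\<^esub> T x"
      using insert by simp_all
    have eq: "(\<lambda>i. if i \<in> insert j J then c i \<odot>\<^bsub>X i\<^esub> x i else x i) = ?x(j := c j \<odot>\<^bsub>X j\<^esub> x j)"
      and id: "?x(j := x j) = ?x"
      using insert.hyps by (auto simp: fun_eq_iff)
    have "T (?x(j := c j \<odot>\<^bsub>X j\<^esub> x j)) = c j \<odot>\<^bsub>Y\<^esub> T ?x"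
      using multilinear_smult[OF T IH(1) j c[OF j] xj] id by simp
    moreover have "?x(j := c j \<odot>\<^bsub>X j\<^esub> x j) \<in> tuples n X"
      by (intro tuples_update IH j factors_smult_closed c xj)
    ultimately show ?case
      using insert.hyps IH c[OF j] Y.scalar_closed(2) multilinear_closed[OF T x]
      unfolding eq by (simp add: Y.scale_scale)
  qed
qed

lemma multilinear_bound:
  assumes a: "\<And>x. x \<in> unit_tuples n X \<Longrightarrow> vnorm Y (T x) \<le> a" and x: "x \<in> tuples n X"
  shows "vnorm Y (T x) \<le> a * (\<Prod>i=1..n. vnorm (X i) (x i))"
proof (cases "\<exists>i\<in>{1..n}. vnorm (X i) (x i) = 0")
  case True
  then obtain i where i: "i \<in> {1..n}" "vnorm (X i) (x i) = 0" by blast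
  then have "x i = \<zero>\<^bsub>X i\<^esub>"
    using normed_space.vnorm_eq_0_iff[OF factors tuples_component[OF x]] by blast
  then have "vnorm Y (T x) = 0" using multilinear_zero[OF x i(1)] by simp
  moreover have "(\<Prod>i=1..n. vnorm (X i) (x i)) = 0" using i by (intro prod_zero) auto
  ultimately show ?thesis by (simp only: mult_zero_right order_refl)
next
  case False
  then have p: "vnorm (X i) (x i) > 0" if "i \<in> {1..n}" for i
    using vnorm_factor_nonneg[OF x that] that by force
  define c where "c i = complex_of_real (1 / vnorm (X i) (x i))" for i
  define y where "y = (\<lambda>i. if i \<in> {1..n} then c i \<odot>\<^bsub>X i\<^esub> x i else x i)"
  define P where "P = (\<Prod>i=1..n. vnorm (X i) (x i))"
  have P: "P > 0" unfolding P_def using p by (intro prod_pos) auto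
  have cK: "c i \<in> K" for i by (simp only: c_def of_real_mem)
  have y: "y \<in> tuples n X" "(\<Prod>i=1..n. c i) \<in> K" "T y = (\<Prod>i=1..n. c i) \<odot>\<^bsub>Y\<^esub> T x"
    using multilinear_scale[OF x cK subset_refl] by (auto simp: y_def)
  have "vnorm (X i) (y i) = 1" if i: "i \<in> {1..n}" for i
    using normed_space.vnorm_smult[OF factors[OF i] cK[of i] tuples_component[OF x i]] p[OF i] i
    by (simp add: y_def c_def norm_divide)
  then have "y \<in> unit_tuples n X" using y(1) by (auto simp: unit_tuples_def)
  moreover have "vnorm Y (T y) = cmod (\<Prod>i=1..n. c i) * vnorm Y (T x)"
    using y multilinear_closed[OF T x] by (simp add: Y.vnorm_smult)
  moreover have "cmod (\<Prod>i=1..n. c i) = (\<Prod>i=1..n. 1 / vnorm (X i) (x i))"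
    unfolding prod_norm[symmetric] using less_imp_le[OF p]
    by (intro prod.cong) (auto simp: c_def norm_divide)
  then have "cmod (\<Prod>i=1..n. c i) = 1 / P" by (simp add: P_def prod_dividef)
  ultimately have "vnorm Y (T x) \<le> a * P" using a[of y] P by (simp add: divide_le_eq)
  then show ?thesis by (simp only: P_def)
qed

end

lemma mnorm_upper:
  "bounded_multilinear K n X Y T \<Longrightarrow> x \<in> unit_tuples n X \<Longrightarrow> vnorm Y (T x) \<le> mnorm n X Y T"
  unfolding mnorm_def bounded_multilinear_def by (elim conjE) (rule cSup_upper[OF imageI])

lemma mnorm_least:
  "(\<And>x. x \<in> unit_tuples n X \<Longrightarrow> vnorm Y (T x) \<le> a) \<Longrightarrow> mnorm n X Y T \<le> a"
  unfolding mnorm_def using zero_tuple_mem by (intro cSUP_least) auto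

lemma mnorm_nonneg:
  assumes "normed_space K Y" "bounded_multilinear K n X Y T"
  shows "0 \<le> mnorm n X Y T"
proof -
  have "T zero_tuple \<in> carrier Y"
    using assms(2) zero_tuple_mem multilinear_closed[of K n X Y T zero_tuple]
    by (simp add: bounded_multilinear_def unit_tuples_def)
  then have "0 \<le> vnorm Y (T zero_tuple)"
    using normed_space.vnorm_nonneg[OF assms(1)] by blast
  also have "\<dots> \<le> mnorm n X Y T" by (rule mnorm_upper[OF assms(2) zero_tuple_mem])
  finally show ?thesis .
qed

end

section \<open>Factorizations as domination of distances\<close>

text \<open>The vector type of \<open>H\<close> is free, and \<open>a\<close> and \<open>L\<close>
  are upper bounds instead of the exact constants, so spaces can be combined and constants rescaled
  without computing suprema or infima.\<close>

definition hilbert_dominated ::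
    "complex set \<Rightarrow> nat \<Rightarrow> (nat \<Rightarrow> 'a nspace) \<Rightarrow> 'b nspace \<Rightarrow> ((nat \<Rightarrow> 'a) \<Rightarrow> 'b) \<Rightarrow>
     'h nspace \<Rightarrow> ((nat \<Rightarrow> 'a) \<Rightarrow> 'h) \<Rightarrow> real \<Rightarrow> real \<Rightarrow> bool" where
  "hilbert_dominated K n X Y T H A a L \<longleftrightarrow>
     hilbert_space K H \<and> multilinear K n X H A \<and>
     (\<forall>x\<in>unit_tuples n X. vnorm H (A x) \<le> a) \<and>
     (\<forall>x\<in>tuples n X. \<forall>y\<in>tuples n X. vdist Y (T x) (T y) \<le> L * vdist H (A x) (A y))"

lemma hilbert_space_normed: "hilbert_space K H \<Longrightarrow> normed_space K H"
  by (simp add: hilbert_space_def banach_space_def)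

lemma Lip_nonneg: "lip_consts H Y M B \<noteq> {} \<Longrightarrow> 0 \<le> Lip H Y M B"
  unfolding Lip_def by (rule cInf_greatest) (auto simp: lip_consts_def)

lemma Lip_upper: "L \<in> lip_consts H Y M B \<Longrightarrow> Lip H Y M B \<le> L"
  unfolding Lip_def by (rule cInf_lower) (auto simp: lip_consts_def intro: bdd_belowI[of _ 0])

text \<open>For two given points the Lipschitz inequality is a closed condition on the constant, so
  it passes to the infimum.\<close>

lemma Lip_attained:
  assumes H: "normed_space K H" and M: "M \<subseteq> carrier H" and ne: "lip_consts H Y M B \<noteq> {}"
    and x: "x \<in> M" "y \<in> M"
  shows "vdist Y (B x) (B y) \<le> Lip H Y M B * vdist H x y"
proof (rule field_le_epsilon)
  fix e :: real assume e: "0 < e"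
  interpret normed_space K H by (rule H)
  have d: "0 \<le> vdist H x y" using x M by (intro vdist_nonneg) auto
  \<comment> \<open>The 1 keeps the denominator positive when the points coincide; the excess
    \<open>e'\<close> over the infimum then costs at most \<open>e\<close>.\<close>
  define e' where "e' = e / (vdist H x y + 1)"
  have e': "e' > 0" using e d by (simp add: e'_def)
  obtain L where L: "L \<in> lip_consts H Y M B" "L < Lip H Y M B + e'"
    using cInf_lessD[OF ne, of "Lip H Y M B + e'"] e' by (auto simp: Lip_def)
  have "vdist Y (B x) (B y) \<le> L * vdist H x y" using L(1) x by (auto simp: lip_consts_def)
  also have "\<dots> \<le> (Lip H Y M B + e') * vdist H x y" using L d by (intro mult_right_mono) auto
  also have "\<dots> \<le> Lip H Y M B * vdist H x y + e' * (vdist H x y + 1)"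
    using e' by (simp add: algebra_simps)
  also have "e' * (vdist H x y + 1) = e" using d by (simp add: e'_def)
  finally show "vdist Y (B x) (B y) \<le> Lip H Y M B * vdist H x y + e" by simp
qed

context factor_spaces
begin

definition factor_costs :: "'b nspace \<Rightarrow> ((nat \<Rightarrow> 'a) \<Rightarrow> 'b) \<Rightarrow> real set" where
  "factor_costs Y T = {mnorm n X H A * Lip H Y M B | (H :: 'a hvec nspace) M A B.
     hilbert_factorization K n X Y T H M A B}"

lemma factor_costs_nonneg: "g \<in> factor_costs Y T \<Longrightarrow> 0 \<le> g"
  by (auto simp: factor_costs_def hilbert_factorization_def
      intro!: mult_nonneg_nonneg mnorm_nonneg Lip_nonneg hilbert_space_normed)

lemma Gamma_norm_upper: "g \<in> factor_costs Y T \<Longrightarrow> Gamma_norm K n X Y T \<le> g"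
  unfolding Gamma_norm_def factor_costs_def[symmetric]
  by (rule cInf_lower) (auto intro: bdd_belowI[of _ 0] factor_costs_nonneg)

lemma factor_costs_nonempty: "factors_through_hilbert K n X Y T \<Longrightarrow> factor_costs Y T \<noteq> {}"
  by (auto simp: factors_through_hilbert_def factor_costs_def)

lemma Gamma_norm_nonneg: "factors_through_hilbert K n X Y T \<Longrightarrow> 0 \<le> Gamma_norm K n X Y T"
  unfolding Gamma_norm_def factor_costs_def[symmetric]
  by (intro cInf_greatest factor_costs_nonempty factor_costs_nonneg)

text \<open>The distance estimate makes \<open>T\<close> constant on the fibres of \<open>A\<close>,
  so any choice of preimages defines the Lipschitz map \<open>B\<close> on the range of
  \<open>A\<close>. The vector type of \<open>H\<close> is arbitrary, which lets the later
  constructions ignore the type fixed in \<open>Gamma_norm\<close>.\<close>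

lemma hilbert_dominated_factors:
  fixes H :: "'h nspace"
  assumes Y: "normed_space K Y" and T: "T \<in> tuples n X \<rightarrow> carrier Y" and L: "0 \<le> L"
    and dom: "hilbert_dominated K n X Y T H A a L"
  shows "factors_through_hilbert K n X Y T" and "Gamma_norm K n X Y T \<le> a * L"
proof -
  interpret Y: normed_space K Y by (rule Y)
  have H: "hilbert_space K H" and A: "multilinear K n X H A"
    and a: "vnorm H (A x) \<le> a" if "x \<in> unit_tuples n X" for x
    using dom that zero_tuple_mem by (auto simp: hilbert_dominated_def)
  \<comment> \<open>The premise on a unit tuple also governs the two facts that do not mention
    \<open>x\<close>; the unit ball is nonempty, which removes it.\<close>
  note H = H[OF zero_tuple_mem] and A = A[OF zero_tuple_mem]
  interpret H: normed_space K H by (rule hilbert_space_normed[OF H])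
  have Lip: "vdist Y (T x) (T y) \<le> L * vdist H (A x) (A y)"
    if "x \<in> tuples n X" "y \<in> tuples n X" for x y
    using dom that by (simp add: hilbert_dominated_def)
  note Ac = multilinear_closed[OF A]
  define B where "B h = T (SOME x. x \<in> tuples n X \<and> A x = h)" for h
  have BA: "B (A x) = T x" if x: "x \<in> tuples n X" for x
  proof -
    define x' where "x' = (SOME x'. x' \<in> tuples n X \<and> A x' = A x)"
    have x': "x' \<in> tuples n X" "A x' = A x"
      unfolding x'_def using someI[of "\<lambda>x'. x' \<in> tuples n X \<and> A x' = A x" x] x by auto
    then have "vdist Y (T x') (T x) \<le> 0" using Lip[OF x'(1) x] Ac[OF x] by simp
    moreover have "T x' \<in> carrier Y" "T x \<in> carrier Y" using T x x'(1) by auto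
    ultimately have "T x' = T x"
      using Y.vdist_nonneg[of "T x'" "T x"] by (intro Y.vdist_eq_0) auto
    then show ?thesis by (simp add: B_def x'_def[symmetric])
  qed
  let ?M = "A ` tuples n X"
  have LM: "L \<in> lip_consts H Y ?M B" using L Lip BA by (auto simp: lip_consts_def)
  have bm: "bounded_multilinear K n X H A"
    using A a by (auto simp: bounded_multilinear_def intro!: bdd_aboveI[of _ a])
  have "hilbert_factorization K n X Y T H ?M A B"
    using H bm LM BA T Ac by (auto simp: hilbert_factorization_def)
  \<comment> \<open>Passage to the prescribed vector type: the norm of the inner map is kept and the
    Lipschitz constant does not grow.\<close>
  from hilbert_factorization_universal[OF field this]
  obtain H' :: "'a hvec nspace" and M' A' B' where
    f: "hilbert_factorization K n X Y T H' M' A' B'"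
      "mnorm n X H' A' = mnorm n X H A" "Lip H' Y M' B' \<le> Lip H Y ?M B"
    by blast
  show "factors_through_hilbert K n X Y T" using f by (auto simp: factors_through_hilbert_def)
  have "Gamma_norm K n X Y T \<le> mnorm n X H' A' * Lip H' Y M' B'"
    using f(1) by (intro Gamma_norm_upper) (auto simp: factor_costs_def)
  also have "\<dots> \<le> a * L"
  proof (rule mult_mono)
    show "mnorm n X H' A' \<le> a" unfolding f(2) by (rule mnorm_least) (rule a)
    then show "0 \<le> a"
      using mnorm_nonneg[OF H.normed_space_axioms bm] f(2) by simp
    show "Lip H' Y M' B' \<le> L" using f(3) Lip_upper[OF LM] by simp
    show "0 \<le> Lip H' Y M' B'" using f(1) by (intro Lip_nonneg) (simp add: hilbert_factorization_def)
  qed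
  finally show "Gamma_norm K n X Y T \<le> a * L" .
qed

text \<open>The slack \<open>g\<close> replaces attainment of the infimum; the bounds obtained are
  the norm of \<open>A\<close> and the least Lipschitz constant of \<open>B\<close>.\<close>

lemma hilbert_dominated_of_Gamma_less:
  assumes "factors_through_hilbert K n X Y T" "Gamma_norm K n X Y T < g"
  obtains H :: "'a hvec nspace" and A a L
  where "hilbert_dominated K n X Y T H A a L" "0 \<le> a" "0 \<le> L" "a * L < g"
proof -
  obtain g' where "g' \<in> factor_costs Y T" "g' < g"
    using cInf_lessD[OF factor_costs_nonempty[OF assms(1)]
        assms(2)[unfolded Gamma_norm_def factor_costs_def[symmetric]]]
    by blast
  then obtain H :: "'a hvec nspace" and M A B
    where f: "hilbert_factorization K n X Y T H M A B" and g: "mnorm n X H A * Lip H Y M B < g"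
    by (auto simp: factor_costs_def)
  from f have H: "hilbert_space K H" and M: "M \<subseteq> carrier H" and A: "bounded_multilinear K n X H A"
    and AM: "A ` tuples n X \<subseteq> M" and ne: "lip_consts H Y M B \<noteq> {}"
    and T: "\<forall>x\<in>tuples n X. T x = B (A x)"
    by (auto simp: hilbert_factorization_def)
  note nH = hilbert_space_normed[OF H]
  have "hilbert_dominated K n X Y T H A (mnorm n X H A) (Lip H Y M B)"
    unfolding hilbert_dominated_def
    using H A AM T Lip_attained[OF nH M ne] mnorm_upper[OF A]
    by (auto simp: bounded_multilinear_def image_subset_iff)
  then show ?thesis using that g mnorm_nonneg[OF nH A] Lip_nonneg[OF ne] by blast
qed

text \<open>Multiplying \<open>A\<close> by a positive \<open>c\<close> turns the pair (a, L) into
  (c a, L / c). As \<open>a * L < g\<close>, some \<open>c\<close> brings both numbers below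
  \<open>sqrt g\<close>.\<close>

lemma hilbert_dominated_balanced:
  assumes dom: "hilbert_dominated K n X Y T H A a L" "0 \<le> a" "0 \<le> L" "a * L < g"
    and Y: "normed_space K Y"
  obtains A' where "hilbert_dominated K n X Y T H A' (sqrt g) (sqrt g)"
proof -
  have H: "hilbert_space K H" and A: "multilinear K n X H A"
    using dom by (auto simp: hilbert_dominated_def)
  interpret H: normed_space K H by (rule hilbert_space_normed[OF H])
  have "0 \<le> a * L" using dom by simp
  then have g: "0 < g" using dom(4) by linarith
  \<comment> \<open>For nonzero \<open>a\<close> the choice \<open>sqrt g / a\<close> makes the
    second condition an equality and the third one \<open>L \<le> g / a\<close>. For
    \<open>a = 0\<close> only the third condition restricts \<open>c\<close>, and the added 1 keeps
    \<open>c\<close> positive when \<open>L = 0\<close>.\<close>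
  obtain c where c: "0 < c" "c * a \<le> sqrt g" "L \<le> sqrt g * c"
  proof (cases "a = 0")
    case True
    show ?thesis
      by (rule that[of "L / sqrt g + 1"]) (use True g dom in \<open>auto simp: field_simps add_nonneg_pos\<close>)
  next
    case False
    have "sqrt g * (sqrt g / a) = g / a" using g by simp
    then show ?thesis
      using that[of "sqrt g / a"] False g dom by (simp add: field_simps)
  qed
  let ?A = "\<lambda>x. complex_of_real c \<odot>\<^bsub>H\<^esub> A x"
  note cK = of_real_mem[of c]
  have "multilinear K n X H ?A" by (rule multilinear_scaled[OF A H.normed_space_axioms cK])
  moreover have "vnorm H (?A x) \<le> sqrt g" if x: "x \<in> unit_tuples n X" for x
  proof -
    have "vnorm H (?A x) = c * vnorm H (A x)"
      using H.vnorm_smult[OF cK multilinear_closed[OF A]] x c(1) by (auto simp: unit_tuples_def)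
    also have "\<dots> \<le> c * a"
      using dom(1) x c(1) by (intro mult_left_mono) (auto simp: hilbert_dominated_def)
    finally show ?thesis using c(2) by linarith
  qed
  moreover have "vdist Y (T x) (T y) \<le> sqrt g * vdist H (?A x) (?A y)"
    if x: "x \<in> tuples n X" "y \<in> tuples n X" for x y
  proof -
    have Ac: "A x \<in> carrier H" "A y \<in> carrier H" using multilinear_closed[OF A] x by auto
    have "vdist Y (T x) (T y) \<le> L * vdist H (A x) (A y)"
      using dom(1) x by (simp add: hilbert_dominated_def)
    also have "\<dots> \<le> (sqrt g * c) * vdist H (A x) (A y)"
      using c(3) H.vdist_nonneg[OF Ac] by (rule mult_right_mono)
    also have "\<dots> = sqrt g * vdist H (?A x) (?A y)"
      using H.vdist_smult[OF cK Ac] c(1) by simp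
    finally show ?thesis .
  qed
  ultimately have "hilbert_dominated K n X Y T H ?A (sqrt g) (sqrt g)"
    using H by (simp add: hilbert_dominated_def)
  then show ?thesis by (rule that)
qed

end

section \<open>The space of factorizable operators\<close>

lemma vdist_scalar_field:
  assumes "K = \<real> \<or> K = UNIV" "c \<in> K" "d \<in> K"
  shows "vdist (scalar_field K) c d = cmod (c - d)"
  using normed_space.vdist_scale_left[OF normed_scalar_field[OF assms(1)] assms(2,3), of 1] assms(1)
  by auto

lemma Gamma_space_simps [simp]:
  "T \<in> carrier (Gamma_space K n X Y) \<longleftrightarrow>
     T \<in> extensional (tuples n X) \<and> multilinear K n X Y T \<and> factors_through_hilbert K n X Y T"
  "\<zero>\<^bsub>Gamma_space K n X Y\<^esub> = (\<lambda>x\<in>tuples n X. \<zero>\<^bsub>Y\<^esub>)"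
  "S \<oplus>\<^bsub>Gamma_space K n X Y\<^esub> T = (\<lambda>x\<in>tuples n X. S x \<oplus>\<^bsub>Y\<^esub> T x)"
  "c \<odot>\<^bsub>Gamma_space K n X Y\<^esub> T = (\<lambda>x\<in>tuples n X. c \<odot>\<^bsub>Y\<^esub> T x)"
  "vnorm (Gamma_space K n X Y) = Gamma_norm K n X Y"
  by (auto simp: Gamma_space_def)

text \<open>Lets \<open>g\<close> decrease to \<Gamma>(T) behind a constant factor. For
  \<open>c = 0\<close> division is impossible, but a single \<open>g\<close> already gives the
  claim.\<close>

lemma le_mult_dense:
  fixes c G x :: real
  assumes "0 \<le> c" "\<And>g. G < g \<Longrightarrow> x \<le> c * g"
  shows "x \<le> c * G"
proof (cases "c = 0")
  case True
  then show ?thesis using assms(2)[of "G + 1"] by simp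
next
  case False
  then have c: "0 < c" using assms(1) by simp
  have "x / c \<le> G"
    by (rule dense_ge) (use assms(2) c in \<open>simp add: divide_le_eq mult.commute\<close>)
  then show ?thesis using c by (simp add: divide_le_eq mult.commute)
qed

lemma cauchy_schwarz_two:
  fixes a b c d :: real
  shows "a * c + b * d \<le> sqrt (a\<^sup>2 + b\<^sup>2) * sqrt (c\<^sup>2 + d\<^sup>2)"
  unfolding real_sqrt_mult[symmetric]
proof (rule real_le_rsqrt)
  \<comment> \<open>Lagrange's identity: the two sides of the next inequality differ by exactly this
    square.\<close>
  have "0 \<le> (a * d - b * c)\<^sup>2" by simp
  then show "(a * c + b * d)\<^sup>2 \<le> (a\<^sup>2 + b\<^sup>2) * (c\<^sup>2 + d\<^sup>2)"
    by (simp add: power2_eq_square algebra_simps)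
qed

locale factor_spaces_target = factor_spaces K n X + Y: normed_space K Y
  for K n and X :: "nat \<Rightarrow> 'a nspace" and Y :: "'b nspace"
begin

abbreviation "\<Gamma> \<equiv> Gamma_space K n X Y"

lemma Gamma_memI:
  assumes "multilinear K n X Y T" "factors_through_hilbert K n X Y (restrict T (tuples n X))"
  shows "restrict T (tuples n X) \<in> carrier \<Gamma>"
  using assms multilinear_cong[OF assms(1), of "restrict T (tuples n X)"] by simp

lemma hilbert_dominated_restrict:
  "hilbert_dominated K n X Y (restrict T (tuples n X)) H A a L \<longleftrightarrow> hilbert_dominated K n X Y T H A a L"
  by (simp add: hilbert_dominated_def)

text \<open>The restriction appears because elements of the space are extensional. One domination
  yields membership and norm estimate together, so the closure properties and the upper bounds below
  share their proofs.\<close>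

lemma Gamma_domI:
  assumes T: "multilinear K n X Y T" and L: "0 \<le> L" and dom: "hilbert_dominated K n X Y T H A a L"
  shows "restrict T (tuples n X) \<in> carrier \<Gamma>" and "Gamma_norm K n X Y (restrict T (tuples n X)) \<le> a * L"
proof -
  have "restrict T (tuples n X) \<in> tuples n X \<rightarrow> carrier Y" using multilinear_closed[OF T] by auto
  note hilbert_dominated_factors[OF Y.normed_space_axioms this L
      dom[folded hilbert_dominated_restrict[of T]]]
  then show "restrict T (tuples n X) \<in> carrier \<Gamma>"
    "Gamma_norm K n X Y (restrict T (tuples n X)) \<le> a * L"
    using Gamma_memI[OF T] by auto
qed

section \<open>Rank-one operators and the lower bound for \<Gamma>\<close>

lemma rank_one:
  assumes \<phi>: "bounded_multilinear K n X (scalar_field K) \<phi>" and y: "y \<in> carrier Y"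
  shows "(\<lambda>x\<in>tuples n X. \<phi> x \<odot>\<^bsub>Y\<^esub> y) \<in> carrier \<Gamma>"
    and "Gamma_norm K n X Y (\<lambda>x\<in>tuples n X. \<phi> x \<odot>\<^bsub>Y\<^esub> y) \<le> mnorm n X (scalar_field K) \<phi> * vnorm Y y"
proof -
  have m: "multilinear K n X (scalar_field K) \<phi>" using \<phi> by (simp add: bounded_multilinear_def)
  have \<phi>K: "\<phi> x \<in> K" if "x \<in> tuples n X" for x using multilinear_closed[OF m that] by simp
  have "multilinear K n X Y (\<lambda>x. \<phi> x \<odot>\<^bsub>Y\<^esub> y)"
    unfolding multilinear_def
    using multilinear_add[OF m] multilinear_smult[OF m] \<phi>K y
    by (auto simp: Y.scale_left_distrib Y.scale_scale)
  moreover have "hilbert_dominated K n X Y (\<lambda>x. \<phi> x \<odot>\<^bsub>Y\<^esub> y) (scalar_field K) \<phi>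
      (mnorm n X (scalar_field K) \<phi>) (vnorm Y y)"
    unfolding hilbert_dominated_def
    using m mnorm_upper[OF \<phi>] hilbert_scalar_field[OF field] \<phi>K y
    by (auto simp: Y.vdist_scale_left vdist_scalar_field[OF field])
  ultimately show "(\<lambda>x\<in>tuples n X. \<phi> x \<odot>\<^bsub>Y\<^esub> y) \<in> carrier \<Gamma>"
    "Gamma_norm K n X Y (\<lambda>x\<in>tuples n X. \<phi> x \<odot>\<^bsub>Y\<^esub> y) \<le> mnorm n X (scalar_field K) \<phi> * vnorm Y y"
    using Gamma_domI Y.vnorm_nonneg[OF y] by blast+
qed

text \<open>Besides the comparison of norms, this pointwise form gives the definiteness of \<Gamma>
  and the bound on \<open>T\<close> that its linearization requires.\<close>

lemma vnorm_le_Gamma_norm: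
  assumes T: "T \<in> carrier \<Gamma>" and x: "x \<in> unit_tuples n X"
  shows "vnorm Y (T x) \<le> Gamma_norm K n X Y T"
proof (rule dense_ge)
  fix g assume g: "Gamma_norm K n X Y T < g"
  have "factors_through_hilbert K n X Y T" using T by simp
  then obtain H :: "'a hvec nspace" and A a L
    where dom: "hilbert_dominated K n X Y T H A a L" "0 \<le> a" "0 \<le> L" "a * L < g"
    using g by (rule hilbert_dominated_of_Gamma_less)
  have m: "multilinear K n X Y T" "multilinear K n X H A" and H: "hilbert_space K H"
    using T dom by (auto simp: hilbert_dominated_def)
  interpret H: normed_space K H by (rule hilbert_space_normed[OF H])
  \<comment> \<open>A slot exists because \<open>n\<close> is positive; with zero in it,
    \<open>T\<close> and \<open>A\<close> both vanish at the zero tuple, and the distance estimate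
    against that tuple becomes |T x| \<le> L |A x|.\<close>
  have 1: "1 \<in> {1..n}" using pos by simp
  have xz: "x \<in> tuples n X" "zero_tuple \<in> tuples n X" using x zero_tuple_mem unit_tuples_subset by auto
  have z: "zero_tuple 1 = \<zero>\<^bsub>X 1\<^esub>" using 1 by (simp add: zero_tuple_def)
  have "vnorm Y (T x) = vdist Y (T x) (T zero_tuple)"
    using multilinear_zero[OF Y.normed_space_axioms m(1) xz(2) 1 z] multilinear_closed[OF m(1) xz(1)]
    by (simp add: Y.vdist_zero_right)
  also have "\<dots> \<le> L * vdist H (A x) (A zero_tuple)"
    using dom(1) xz by (simp add: hilbert_dominated_def)
  also have "\<dots> = L * vnorm H (A x)"
    using multilinear_zero[OF H.normed_space_axioms m(2) xz(2) 1 z] multilinear_closed[OF m(2) xz(1)]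
    by (simp add: H.vdist_zero_right)
  also have "\<dots> \<le> L * a" using dom x by (intro mult_left_mono) (auto simp: hilbert_dominated_def)
  finally show "vnorm Y (T x) \<le> g" using dom(4) by (simp add: mult.commute)
qed

lemma Gamma_bounded:
  assumes T: "T \<in> carrier \<Gamma>"
  shows "bounded_multilinear K n X Y T" and "mnorm n X Y T \<le> Gamma_norm K n X Y T"
  using T vnorm_le_Gamma_norm[OF T]
  by (auto simp: bounded_multilinear_def intro!: mnorm_least bdd_aboveI[of _ "Gamma_norm K n X Y T"])

section \<open>Linear structure and norm axioms\<close>

text \<open>For arbitrary constants (a, L) and (b, M) the direct sum costs sqrt(a^2 + b^2) sqrt(L^2
  + M^2), which may exceed aL + bM. Balancing makes the vectors (a, b) and (L, M) equal, both roots
  become sqrt(g + g'), and the cost is g + g'.\<close>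

lemma Gamma_add:
  assumes S: "S \<in> carrier \<Gamma>" and T: "T \<in> carrier \<Gamma>"
  shows "S \<oplus>\<^bsub>\<Gamma>\<^esub> T \<in> carrier \<Gamma>"
    and "Gamma_norm K n X Y (S \<oplus>\<^bsub>\<Gamma>\<^esub> T) \<le> Gamma_norm K n X Y S + Gamma_norm K n X Y T"
proof -
  have main: "S \<oplus>\<^bsub>\<Gamma>\<^esub> T \<in> carrier \<Gamma> \<and> Gamma_norm K n X Y (S \<oplus>\<^bsub>\<Gamma>\<^esub> T) \<le> g + g'"
    if g: "Gamma_norm K n X Y S < g" "Gamma_norm K n X Y T < g'" for g g'
  proof -
    have g0: "0 \<le> g" "0 \<le> g'"
      using g Gamma_norm_nonneg[of Y S] Gamma_norm_nonneg[of Y T] S T by auto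
    note Yn = Y.normed_space_axioms
    obtain G :: "'a hvec nspace" and A where A: "hilbert_dominated K n X Y S G A (sqrt g) (sqrt g)"
      using hilbert_dominated_of_Gamma_less[OF _ g(1)] hilbert_dominated_balanced[OF _ _ _ _ Yn] S
      by (metis Gamma_space_simps(1))
    obtain H :: "'a hvec nspace" and B where B: "hilbert_dominated K n X Y T H B (sqrt g') (sqrt g')"
      using hilbert_dominated_of_Gamma_less[OF _ g(2)] hilbert_dominated_balanced[OF _ _ _ _ Yn] T
      by (metis Gamma_space_simps(1))
    have G: "hilbert_space K G" and H: "hilbert_space K H"
      and mA: "multilinear K n X G A" and mB: "multilinear K n X H B"
      using A B by (auto simp: hilbert_dominated_def)
    note nG = hilbert_space_normed[OF G] and nH = hilbert_space_normed[OF H]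
    let ?H = "hilbert_sum G H" and ?A = "\<lambda>x. (A x, B x)"
    have sq: "sqrt g * sqrt g = g" "sqrt g' * sqrt g' = g'" using g0 by simp_all
    have "multilinear K n X ?H ?A"
      using mA mB by (simp add: multilinear_def Pi_iff)
    moreover have "vnorm ?H (?A x) \<le> sqrt (g + g')" if "x \<in> unit_tuples n X" for x
    proof -
      have "A x \<in> carrier G" "B x \<in> carrier H"
        using multilinear_closed[OF mA] multilinear_closed[OF mB] that by (auto simp: unit_tuples_def)
      then have "0 \<le> vnorm G (A x)" "0 \<le> vnorm H (B x)"
        using normed_space.vnorm_nonneg[OF nG] normed_space.vnorm_nonneg[OF nH] by auto
      moreover have "vnorm G (A x) \<le> sqrt g" "vnorm H (B x) \<le> sqrt g'"
        using A B that by (auto simp: hilbert_dominated_def)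
      ultimately have "(vnorm G (A x))\<^sup>2 \<le> (sqrt g)\<^sup>2" "(vnorm H (B x))\<^sup>2 \<le> (sqrt g')\<^sup>2"
        by (auto intro!: power_mono)
      then show ?thesis using g0 by simp
    qed
    moreover have "vdist Y (S x \<oplus>\<^bsub>Y\<^esub> T x) (S y \<oplus>\<^bsub>Y\<^esub> T y) \<le> sqrt (g + g') * vdist ?H (?A x) (?A y)"
      if xy: "x \<in> tuples n X" "y \<in> tuples n X" for x y
    proof -
      have c: "S x \<in> carrier Y" "S y \<in> carrier Y" "T x \<in> carrier Y" "T y \<in> carrier Y"
        using S T xy multilinear_closed by auto
      have c': "?A x \<in> carrier ?H" "?A y \<in> carrier ?H"
        using multilinear_closed[OF mA] multilinear_closed[OF mB] xy by auto
      have "vdist Y (S x \<oplus>\<^bsub>Y\<^esub> T x) (S y \<oplus>\<^bsub>Y\<^esub> T y) \<le> vdist Y (S x) (S y) + vdist Y (T x) (T y)"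
        using c by (intro Y.vdist_add) auto
      also have "\<dots> \<le> sqrt g * vdist G (A x) (A y) + sqrt g' * vdist H (B x) (B y)"
        using A B xy by (intro add_mono) (auto simp: hilbert_dominated_def)
      \<comment> \<open>Cauchy-Schwarz for the vector of the two Lipschitz constants and the vector
        of the two distances; the second root is the distance in the direct sum.\<close>
      also have "\<dots> \<le> sqrt ((sqrt g)\<^sup>2 + (sqrt g')\<^sup>2) * sqrt ((vdist G (A x) (A y))\<^sup>2 + (vdist H (B x) (B y))\<^sup>2)"
        by (rule cauchy_schwarz_two)
      also have "\<dots> = sqrt (g + g') * vdist ?H (?A x) (?A y)"
        using g0 vdist_hilbert_sum[OF nG nH c'] by simp
      finally show ?thesis .
    qed
    ultimately have dom: "hilbert_dominated K n X Y (\<lambda>x. S x \<oplus>\<^bsub>Y\<^esub> T x) ?H ?A (sqrt (g + g')) (sqrt (g + g'))"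
      using hilbert_hilbert_sum[OF G H] by (simp add: hilbert_dominated_def)
    have "multilinear K n X Y (\<lambda>x. S x \<oplus>\<^bsub>Y\<^esub> T x)"
      using S T by (intro multilinear_sum Yn) auto
    note Gamma_domI[OF this _ dom]
    then show ?thesis using g0 by (simp only: Gamma_space_simps(3)) simp
  qed
  \<comment> \<open>Membership does not depend on the slack, so any slack will do, here 1.\<close>
  show "S \<oplus>\<^bsub>\<Gamma>\<^esub> T \<in> carrier \<Gamma>"
    using main[of "Gamma_norm K n X Y S + 1" "Gamma_norm K n X Y T + 1"] by simp
  show "Gamma_norm K n X Y (S \<oplus>\<^bsub>\<Gamma>\<^esub> T) \<le> Gamma_norm K n X Y S + Gamma_norm K n X Y T"
  proof (rule field_le_epsilon)
    fix e :: real assume "0 < e"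
    then show "Gamma_norm K n X Y (S \<oplus>\<^bsub>\<Gamma>\<^esub> T) \<le> Gamma_norm K n X Y S + Gamma_norm K n X Y T + e"
      using main[of "Gamma_norm K n X Y S + e/2" "Gamma_norm K n X Y T + e/2"] by simp
  qed
qed

text \<open>The scalar is charged to the Lipschitz constant, so \<open>A\<close> stays the same.
  Equality of the norms comes later, from this estimate applied to the inverse scalar.\<close>

lemma Gamma_smult_le:
  assumes T: "T \<in> carrier \<Gamma>" and c: "c \<in> K"
  shows "c \<odot>\<^bsub>\<Gamma>\<^esub> T \<in> carrier \<Gamma>"
    and "Gamma_norm K n X Y (c \<odot>\<^bsub>\<Gamma>\<^esub> T) \<le> cmod c * Gamma_norm K n X Y T"
proof -
  have main: "c \<odot>\<^bsub>\<Gamma>\<^esub> T \<in> carrier \<Gamma> \<and> Gamma_norm K n X Y (c \<odot>\<^bsub>\<Gamma>\<^esub> T) \<le> cmod c * g"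
    if g: "Gamma_norm K n X Y T < g" for g
  proof -
    have "factors_through_hilbert K n X Y T" using T by simp
    then obtain H :: "'a hvec nspace" and A a L
      where dom: "hilbert_dominated K n X Y T H A a L" "0 \<le> a" "0 \<le> L" "a * L < g"
      using g by (rule hilbert_dominated_of_Gamma_less)
    have m: "multilinear K n X Y T" using T by simp
    have "vdist Y (c \<odot>\<^bsub>Y\<^esub> T x) (c \<odot>\<^bsub>Y\<^esub> T y) \<le> cmod c * L * vdist H (A x) (A y)"
      if "x \<in> tuples n X" "y \<in> tuples n X" for x y
      using Y.vdist_smult[OF c] multilinear_closed[OF m] that dom(1)
      by (simp add: hilbert_dominated_def mult.assoc mult_left_mono)
    then have "hilbert_dominated K n X Y (\<lambda>x. c \<odot>\<^bsub>Y\<^esub> T x) H A a (cmod c * L)"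
      using dom(1) by (simp add: hilbert_dominated_def)
    note Gamma_domI[OF multilinear_scaled[OF m Y.normed_space_axioms c] _ this]
    moreover have "a * (cmod c * L) \<le> cmod c * g"
      using mult_left_mono[OF less_imp_le[OF dom(4)], of "cmod c"] by (simp add: ac_simps)
    moreover have "0 \<le> cmod c * L" using dom(3) by simp
    ultimately show ?thesis unfolding Gamma_space_simps(4) by (meson order_trans)
  qed
  show "c \<odot>\<^bsub>\<Gamma>\<^esub> T \<in> carrier \<Gamma>" using main[of "Gamma_norm K n X Y T + 1"] by simp
  show "Gamma_norm K n X Y (c \<odot>\<^bsub>\<Gamma>\<^esub> T) \<le> cmod c * Gamma_norm K n X Y T"
    by (rule le_mult_dense) (use main in auto)
qed

text \<open>The zero operator is the rank-one operator built from the zero form and the zero vector,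
  so its membership and its norm are read off from the rank-one estimate.\<close>

lemma Gamma_zero:
  shows "\<zero>\<^bsub>\<Gamma>\<^esub> \<in> carrier \<Gamma>" and "Gamma_norm K n X Y \<zero>\<^bsub>\<Gamma>\<^esub> = 0"
proof -
  have 0: "0 \<in> K" using of_real_mem[of 0] by simp
  have "bounded_multilinear K n X (scalar_field K) (\<lambda>x. 0)"
    using 0 by (auto simp: bounded_multilinear_def multilinear_def)
  note r = rank_one[OF this Y.M.zero_closed]
  have eq: "(\<lambda>x\<in>tuples n X. 0 \<odot>\<^bsub>Y\<^esub> \<zero>\<^bsub>Y\<^esub>) = \<zero>\<^bsub>\<Gamma>\<^esub>" by simp
  show mem: "\<zero>\<^bsub>\<Gamma>\<^esub> \<in> carrier \<Gamma>" using r(1) unfolding eq .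
  have "Gamma_norm K n X Y \<zero>\<^bsub>\<Gamma>\<^esub> \<le> 0" using r(2) unfolding eq by simp
  moreover have "0 \<le> Gamma_norm K n X Y \<zero>\<^bsub>\<Gamma>\<^esub>" using mem by (intro Gamma_norm_nonneg) simp
  ultimately show "Gamma_norm K n X Y \<zero>\<^bsub>\<Gamma>\<^esub> = 0" by linarith
qed

lemma Gamma_closed: "T \<in> carrier \<Gamma> \<Longrightarrow> x \<in> tuples n X \<Longrightarrow> T x \<in> carrier Y"
  using multilinear_closed[of K n X Y T] by simp

lemma Gamma_eqI:
  "S \<in> carrier \<Gamma> \<Longrightarrow> T \<in> carrier \<Gamma> \<Longrightarrow> (\<And>x. x \<in> tuples n X \<Longrightarrow> S x = T x) \<Longrightarrow> S = T"
  using extensionalityI[of S "tuples n X" T] by simp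

lemma module_Gamma: "module (scalar_field K) \<Gamma>"
proof (rule moduleI)
  show "cring (scalar_field K)" by (rule Y.R.cring_axioms)
  show "abelian_group \<Gamma>"
  proof (rule abelian_groupI)
    fix T assume T: "T \<in> carrier \<Gamma>"
    have "((- 1) \<odot>\<^bsub>\<Gamma>\<^esub> T) \<oplus>\<^bsub>\<Gamma>\<^esub> T = \<zero>\<^bsub>\<Gamma>\<^esub>"
    proof (rule Gamma_eqI)
      fix x assume x: "x \<in> tuples n X"
      note Tx = Gamma_closed[OF T x]
      have "(- 1) \<odot>\<^bsub>Y\<^esub> T x \<oplus>\<^bsub>Y\<^esub> T x = \<zero>\<^bsub>Y\<^esub>"
        using Y.scale_left_distrib[OF Y.neg_one_mem Y.one_mem Tx] Tx by simp
      then show "(((- 1) \<odot>\<^bsub>\<Gamma>\<^esub> T) \<oplus>\<^bsub>\<Gamma>\<^esub> T) x = \<zero>\<^bsub>\<Gamma>\<^esub> x" using x by simp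
    qed (intro Gamma_add Gamma_smult_le T Y.neg_one_mem Gamma_zero)+
    then show "\<exists>S\<in>carrier \<Gamma>. S \<oplus>\<^bsub>\<Gamma>\<^esub> T = \<zero>\<^bsub>\<Gamma>\<^esub>"
      using Gamma_smult_le(1)[OF T Y.neg_one_mem] by (rule bexI)
  next
    fix R S T assume c: "R \<in> carrier \<Gamma>" "S \<in> carrier \<Gamma>" "T \<in> carrier \<Gamma>"
    show "(R \<oplus>\<^bsub>\<Gamma>\<^esub> S) \<oplus>\<^bsub>\<Gamma>\<^esub> T = R \<oplus>\<^bsub>\<Gamma>\<^esub> (S \<oplus>\<^bsub>\<Gamma>\<^esub> T)"
      using c[THEN Gamma_closed] by (intro Gamma_eqI Gamma_add c) (simp add: Y.M.a_assoc)
  next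
    fix S T assume c: "S \<in> carrier \<Gamma>" "T \<in> carrier \<Gamma>"
    show "S \<oplus>\<^bsub>\<Gamma>\<^esub> T = T \<oplus>\<^bsub>\<Gamma>\<^esub> S"
      using c[THEN Gamma_closed] by (intro Gamma_eqI Gamma_add c) (simp add: Y.M.a_comm)
  next
    fix T assume c: "T \<in> carrier \<Gamma>"
    show "\<zero>\<^bsub>\<Gamma>\<^esub> \<oplus>\<^bsub>\<Gamma>\<^esub> T = T"
      using Gamma_closed[OF c] by (intro Gamma_eqI Gamma_add Gamma_zero c) simp
  qed (fact Gamma_add(1) Gamma_zero(1))+
next
  fix c T assume c: "c \<in> carrier (scalar_field K)" and T: "T \<in> carrier \<Gamma>"
  then show "c \<odot>\<^bsub>\<Gamma>\<^esub> T \<in> carrier \<Gamma>" by (intro Gamma_smult_le) simp_all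
next
  fix c d T assume "c \<in> carrier (scalar_field K)" "d \<in> carrier (scalar_field K)" and T: "T \<in> carrier \<Gamma>"
  then have cd: "c \<in> K" "d \<in> K" by simp_all
  note s = cd Y.scalar_closed[OF cd] and Tx = Gamma_closed[OF T]
  have "(c + d) \<odot>\<^bsub>\<Gamma>\<^esub> T = (c \<odot>\<^bsub>\<Gamma>\<^esub> T) \<oplus>\<^bsub>\<Gamma>\<^esub> (d \<odot>\<^bsub>\<Gamma>\<^esub> T)"
    using Tx s by (intro Gamma_eqI Gamma_add Gamma_smult_le T) (simp_all add: Y.scale_left_distrib)
  then show "(c \<oplus>\<^bsub>scalar_field K\<^esub> d) \<odot>\<^bsub>\<Gamma>\<^esub> T = (c \<odot>\<^bsub>\<Gamma>\<^esub> T) \<oplus>\<^bsub>\<Gamma>\<^esub> (d \<odot>\<^bsub>\<Gamma>\<^esub> T)"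
    unfolding scalar_field_simps .
  have "(c * d) \<odot>\<^bsub>\<Gamma>\<^esub> T = c \<odot>\<^bsub>\<Gamma>\<^esub> (d \<odot>\<^bsub>\<Gamma>\<^esub> T)"
    using Tx s by (intro Gamma_eqI Gamma_smult_le T) (simp_all add: Y.scale_scale)
  then show "(c \<otimes>\<^bsub>scalar_field K\<^esub> d) \<odot>\<^bsub>\<Gamma>\<^esub> T = c \<odot>\<^bsub>\<Gamma>\<^esub> (d \<odot>\<^bsub>\<Gamma>\<^esub> T)"
    unfolding scalar_field_simps .
next
  fix c S T assume "c \<in> carrier (scalar_field K)" and S: "S \<in> carrier \<Gamma>" and T: "T \<in> carrier \<Gamma>"
  then have c: "c \<in> K" by simp
  show "c \<odot>\<^bsub>\<Gamma>\<^esub> (S \<oplus>\<^bsub>\<Gamma>\<^esub> T) = (c \<odot>\<^bsub>\<Gamma>\<^esub> S) \<oplus>\<^bsub>\<Gamma>\<^esub> (c \<odot>\<^bsub>\<Gamma>\<^esub> T)"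
    using Gamma_closed[OF S] Gamma_closed[OF T] c
    by (intro Gamma_eqI Gamma_add Gamma_smult_le S T) (simp_all add: Y.scale_right_distrib)
next
  fix T assume T: "T \<in> carrier \<Gamma>"
  have "1 \<odot>\<^bsub>\<Gamma>\<^esub> T = T"
    using Gamma_closed[OF T] Y.one_mem by (intro Gamma_eqI Gamma_smult_le T) simp_all
  then show "\<one>\<^bsub>scalar_field K\<^esub> \<odot>\<^bsub>\<Gamma>\<^esub> T = T" unfolding scalar_field_simps .
qed

lemma normed_Gamma: "normed_space K \<Gamma>"
proof (intro normed_space.intro module_Gamma normed_space_axioms.intro)
  interpret G: module "scalar_field K" \<Gamma> by (rule module_Gamma)
  show nn: "0 \<le> vnorm \<Gamma> T" if "T \<in> carrier \<Gamma>" for T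
    using that Gamma_norm_nonneg[of Y T] by simp
  show "vnorm \<Gamma> T = 0 \<longleftrightarrow> T = \<zero>\<^bsub>\<Gamma>\<^esub>" if T: "T \<in> carrier \<Gamma>" for T
  proof
    assume 0: "vnorm \<Gamma> T = 0"
    show "T = \<zero>\<^bsub>\<Gamma>\<^esub>"
    proof (rule Gamma_eqI[OF T Gamma_zero(1)])
      fix x assume x: "x \<in> tuples n X"
      have m: "multilinear K n X Y T" using T by simp
      \<comment> \<open>\<Gamma>(T) = 0 bounds \<open>T\<close> by 0 on the unit ball only;
        multilinearity carries the bound to every tuple.\<close>
      have "vnorm Y (T x) \<le> 0 * (\<Prod>i=1..n. vnorm (X i) (x i))"
        using vnorm_le_Gamma_norm[OF T] 0
        by (intro multilinear_bound[OF Y.normed_space_axioms m _ x]) simp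
      then have "T x = \<zero>\<^bsub>Y\<^esub>"
        using Y.vnorm_eq_0_iff[of "T x"] Y.vnorm_nonneg[of "T x"] Gamma_closed[OF T x] by simp
      then show "T x = \<zero>\<^bsub>\<Gamma>\<^esub> x" using x by simp
    qed
  next
    assume "T = \<zero>\<^bsub>\<Gamma>\<^esub>"
    then show "vnorm \<Gamma> T = 0" using Gamma_zero(2) by (simp only: Gamma_space_simps(5))
  qed
  show "vnorm \<Gamma> (c \<odot>\<^bsub>\<Gamma>\<^esub> T) = cmod c * vnorm \<Gamma> T" if c: "c \<in> K" and T: "T \<in> carrier \<Gamma>" for c T
  proof (rule antisym)
    show le: "vnorm \<Gamma> (c \<odot>\<^bsub>\<Gamma>\<^esub> T) \<le> cmod c * vnorm \<Gamma> T"
      using Gamma_smult_le(2)[OF T c] by (simp only: Gamma_space_simps(5))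
    show "cmod c * vnorm \<Gamma> T \<le> vnorm \<Gamma> (c \<odot>\<^bsub>\<Gamma>\<^esub> T)"
    proof (cases "c = 0")
      case True
      then show ?thesis using nn[OF Gamma_smult_le(1)[OF T c]] by simp
    next
      case False
      \<comment> \<open>The reverse inequality is the first one for \<open>inverse c\<close> and the
        operator \<open>c\<close> times \<open>T\<close>.\<close>
      have ic: "inverse c \<in> K" using field c by auto
      have "inverse c \<odot>\<^bsub>\<Gamma>\<^esub> (c \<odot>\<^bsub>\<Gamma>\<^esub> T) = T"
        using G.smult_assoc1[of "inverse c" c T] G.smult_one[OF T] ic c T False
        unfolding scalar_field_simps by simp
      then have "vnorm \<Gamma> T \<le> cmod (inverse c) * vnorm \<Gamma> (c \<odot>\<^bsub>\<Gamma>\<^esub> T)"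
        using Gamma_smult_le(2)[OF Gamma_smult_le(1)[OF T c] ic] by (simp only: Gamma_space_simps(5))
      then have "cmod c * vnorm \<Gamma> T \<le> cmod c * (cmod (inverse c) * vnorm \<Gamma> (c \<odot>\<^bsub>\<Gamma>\<^esub> T))"
        by (intro mult_left_mono) auto
      also have "\<dots> = vnorm \<Gamma> (c \<odot>\<^bsub>\<Gamma>\<^esub> T)" using False by (simp add: norm_inverse)
      finally show ?thesis .
    qed
  qed
  show "vnorm \<Gamma> (S \<oplus>\<^bsub>\<Gamma>\<^esub> T) \<le> vnorm \<Gamma> S + vnorm \<Gamma> T"
    if "S \<in> carrier \<Gamma>" "T \<in> carrier \<Gamma>" for S T
    using Gamma_add(2)[OF that] by (simp only: Gamma_space_simps(5))
qed

end

section \<open>Linearization on the projective tensor product\<close>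

context factor_spaces
begin

lemma scalar_normed: "normed_space K (scalar_field K)"
  by (rule normed_scalar_field[OF field])

section \<open>Formal sums modulo the multilinear relations\<close>

abbreviation "formals \<equiv> formal_sums K n X"
abbreviation "relations \<equiv> multilinear_relations K n X"
abbreviation "tclass u \<equiv> tensor_rel K n X `` {u}"
abbreviation "P \<equiv> projective_tensor K n X"

text \<open>Closure of the formal sums is the first half of the facts on \<open>lincomb\<close>; the
  zero map into the scalar field merely instantiates the operator that occurs there.\<close>

lemma formals_add: "u \<in> formals \<Longrightarrow> v \<in> formals \<Longrightarrow> (\<lambda>z. u z + v z) \<in> formals"
  by (rule normed_space.lincomb_add(1)[OF scalar_normed, of "\<lambda>_. 0"]) (use field in auto)

lemma formals_scale: "c \<in> K \<Longrightarrow> u \<in> formals \<Longrightarrow> (\<lambda>z. c * u z) \<in> formals"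
  by (rule normed_space.lincomb_smult(1)[OF scalar_normed, of "\<lambda>_. 0"]) (use field in auto)

lemma formals_zero: "(\<lambda>z. 0) \<in> formals"
  using field by (auto simp: formal_sums_def)

lemma formals_diff: "u \<in> formals \<Longrightarrow> v \<in> formals \<Longrightarrow> (\<lambda>z. u z - v z) \<in> formals"
  using formals_add[of u "\<lambda>z. - 1 * v z"] formals_scale[of "- 1" v] of_real_mem[of "- 1"] by simp

lemma formals_single: "x \<in> tuples n X \<Longrightarrow> single x \<in> formals"
  using field by (auto simp: formal_sums_def single_def)

lemma relations_subset: "u \<in> relations \<Longrightarrow> u \<in> formals"
  by (induction rule: multilinear_relations.induct)
     (auto intro!: formals_zero formals_add formals_diff formals_scale formals_single tuples_update
        factors_add_closed factors_smult_closed)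

text \<open>Relations grow by one scaled generator at a time, so the second summand can be built up
  on top of the first. The same coefficient in front of each generator absorbs a scalar factor in
  the next lemma.\<close>

lemma relations_add:
  assumes "u \<in> relations" "v \<in> relations"
  shows "(\<lambda>z. u z + v z) \<in> relations"
  using assms(2)
proof (induction rule: multilinear_relations.induct)
  case zero
  then show ?case using assms(1) by simp
next
  case (add v c x i a b)
  from multilinear_relations.add[OF add.IH add.hyps(2-)] show ?case by (simp add: add.assoc)
next
  case (smult v c x i r a)
  from multilinear_relations.smult[OF smult.IH smult.hyps(2-)] show ?case by (simp add: add.assoc)
qed

lemma relations_scale:
  assumes "u \<in> relations" "d \<in> K"
  shows "(\<lambda>z. d * u z) \<in> relations"
  using assms(1)
proof (induction rule: multilinear_relations.induct)
  case zero
  then show ?case by (simp add: multilinear_relations.zero)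
next
  case (add v c x i a b)
  have "d * c \<in> K" using normed_space.scalar_closed(2)[OF scalar_normed assms(2) add.hyps(2)] .
  from multilinear_relations.add[OF add.IH this add.hyps(3-)]
  show ?case by (simp add: distrib_left mult.assoc)
next
  case (smult v c x i r a)
  have "d * c \<in> K" using normed_space.scalar_closed(2)[OF scalar_normed assms(2) smult.hyps(2)] .
  from multilinear_relations.smult[OF smult.IH this smult.hyps(3-)]
  show ?case by (simp add: distrib_left mult.assoc)
qed

lemma equiv_tensor_rel: "equiv formals (tensor_rel K n X)"
proof (rule equivI)
  show "tensor_rel K n X \<subseteq> formals \<times> formals" by (auto simp: tensor_rel_def)
  show "refl_on formals (tensor_rel K n X)"
    by (auto simp: refl_on_def tensor_rel_def multilinear_relations.zero)
  show "sym (tensor_rel K n X)"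
  proof (rule symI)
    fix u v assume "(u, v) \<in> tensor_rel K n X"
    then show "(v, u) \<in> tensor_rel K n X"
      using relations_scale[of "\<lambda>z. u z - v z" "- 1"] of_real_mem[of "- 1"]
      by (simp add: tensor_rel_def)
  qed
  show "trans (tensor_rel K n X)"
  proof (rule transI)
    fix u v w assume "(u, v) \<in> tensor_rel K n X" "(v, w) \<in> tensor_rel K n X"
    then show "(u, w) \<in> tensor_rel K n X"
      using relations_add[of "\<lambda>z. u z - v z" "\<lambda>z. v z - w z"] by (simp add: tensor_rel_def)
  qed
qed

lemma tclass_eqI: "(u, v) \<in> tensor_rel K n X \<Longrightarrow> tclass u = tclass v"
  by (rule equiv_class_eq[OF equiv_tensor_rel])

lemma tensor_rel_add:
  assumes "(u, u') \<in> tensor_rel K n X" "(v, v') \<in> tensor_rel K n X"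
  shows "((\<lambda>z. u z + v z), (\<lambda>z. u' z + v' z)) \<in> tensor_rel K n X"
  using relations_add[of "\<lambda>z. u z - u' z" "\<lambda>z. v z - v' z"] assms formals_add
  by (simp add: tensor_rel_def algebra_simps)

lemma tensor_rel_scale:
  assumes "c \<in> K" "(u, u') \<in> tensor_rel K n X"
  shows "((\<lambda>z. c * u z), (\<lambda>z. c * u' z)) \<in> tensor_rel K n X"
  using relations_scale[of "\<lambda>z. u z - u' z" c] assms formals_scale
  by (simp add: tensor_rel_def algebra_simps)

lemma P_carrier: "carrier P = formals // tensor_rel K n X"
  by (simp add: projective_tensor_def)

lemma tclass_closed [simp]: "u \<in> formals \<Longrightarrow> tclass u \<in> carrier P"
  by (simp add: P_carrier quotientI)

lemma P_cases:
  assumes "p \<in> carrier P"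
  obtains u where "u \<in> formals" "p = tclass u"
  using assms by (auto simp: P_carrier elim: quotientE)

lemma tclass_add [simp]:
  assumes "u \<in> formals" "v \<in> formals"
  shows "tclass u \<oplus>\<^bsub>P\<^esub> tclass v = tclass (\<lambda>z. u z + v z)"
proof -
  have "congruent2 (tensor_rel K n X) (tensor_rel K n X) (\<lambda>u v. tclass (\<lambda>z. u z + v z))"
    by (intro congruent2I' tclass_eqI tensor_rel_add)
  from UN_equiv_class2[OF equiv_tensor_rel equiv_tensor_rel this assms] show ?thesis
    by (simp add: projective_tensor_def)
qed

lemma tclass_smult:
  assumes "c \<in> K" "u \<in> formals"
  shows "c \<odot>\<^bsub>P\<^esub> tclass u = tclass (\<lambda>z. c * u z)"
proof -
  have "(\<lambda>u. tclass (\<lambda>z. c * u z)) respects tensor_rel K n X"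
    by (intro congruentI tclass_eqI tensor_rel_scale assms(1))
  from UN_equiv_class[OF equiv_tensor_rel this assms(2)] show ?thesis
    by (simp add: projective_tensor_def)
qed

lemma P_zero: "\<zero>\<^bsub>P\<^esub> = tclass (\<lambda>z. 0)"
  by (simp add: projective_tensor_def)

lemma tclass_neg:
  assumes "u \<in> formals"
  shows "(\<lambda>z. - u z) \<in> formals" "tclass (\<lambda>z. - u z) \<oplus>\<^bsub>P\<^esub> tclass u = \<zero>\<^bsub>P\<^esub>"
proof -
  show "(\<lambda>z. - u z) \<in> formals" using formals_diff[OF formals_zero assms] by simp
  then show "tclass (\<lambda>z. - u z) \<oplus>\<^bsub>P\<^esub> tclass u = \<zero>\<^bsub>P\<^esub>" using assms by (simp add: P_zero)
qed

text \<open>\<open>vdist\<close> is defined by subtraction; the group laws identify the additive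
  inverse of a class with the class of the negated formal sum.\<close>

lemma abelian_group_P: "abelian_group P"
proof (rule abelian_groupI)
  fix p q assume "p \<in> carrier P" "q \<in> carrier P"
  then obtain u v where uv: "u \<in> formals" "p = tclass u" "v \<in> formals" "q = tclass v"
    by (metis P_cases)
  show "p \<oplus>\<^bsub>P\<^esub> q \<in> carrier P" using uv formals_add by simp
  show "p \<oplus>\<^bsub>P\<^esub> q = q \<oplus>\<^bsub>P\<^esub> p" using uv by (simp add: add.commute)
next
  fix p q r assume "p \<in> carrier P" "q \<in> carrier P" "r \<in> carrier P"
  then obtain u v w where "u \<in> formals" "p = tclass u" "v \<in> formals" "q = tclass v"
      "w \<in> formals" "r = tclass w"
    by (metis P_cases)
  then show "p \<oplus>\<^bsub>P\<^esub> q \<oplus>\<^bsub>P\<^esub> r = p \<oplus>\<^bsub>P\<^esub> (q \<oplus>\<^bsub>P\<^esub> r)" by (simp add: formals_add add.assoc)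
next
  fix p assume "p \<in> carrier P"
  then obtain u where u: "u \<in> formals" "p = tclass u" by (rule P_cases)
  show "\<zero>\<^bsub>P\<^esub> \<oplus>\<^bsub>P\<^esub> p = p" using u formals_zero by (simp add: P_zero)
  show "\<exists>q\<in>carrier P. q \<oplus>\<^bsub>P\<^esub> p = \<zero>\<^bsub>P\<^esub>" using u tclass_neg[OF u(1)] tclass_closed by blast
qed (simp add: P_zero formals_zero)

lemma tclass_minus:
  assumes "u \<in> formals" "v \<in> formals"
  shows "tclass u \<ominus>\<^bsub>P\<^esub> tclass v = tclass (\<lambda>z. u z - v z)"
proof -
  interpret P: abelian_group P by (rule abelian_group_P)
  have "\<ominus>\<^bsub>P\<^esub> tclass v = tclass (\<lambda>z. - v z)"
    using tclass_neg[OF assms(2)] assms(2) by (intro P.minus_equality) simp_all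
  then show ?thesis using assms tclass_neg(1)[OF assms(2)] by (simp add: a_minus_def)
qed

section \<open>The projective norm as the infimum of the weights of representatives\<close>

definition weight :: "((nat \<Rightarrow> 'a) \<Rightarrow> complex) \<Rightarrow> real" where
  "weight v = (\<Sum>x | v x \<noteq> 0. cmod (v x) * (\<Prod>i=1..n. vnorm (X i) (x i)))"

lemma weight_superset:
  "finite S \<Longrightarrow> {x. v x \<noteq> 0} \<subseteq> S \<Longrightarrow>
    weight v = (\<Sum>x\<in>S. cmod (v x) * (\<Prod>i=1..n. vnorm (X i) (x i)))"
  unfolding weight_def by (rule sum.mono_neutral_left) auto

lemma prod_vnorm_nonneg: "x \<in> tuples n X \<Longrightarrow> 0 \<le> (\<Prod>i=1..n. vnorm (X i) (x i))"
  by (intro prod_nonneg ballI vnorm_factor_nonneg)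

lemma weight_nonneg: "v \<in> formals \<Longrightarrow> 0 \<le> weight v"
  unfolding weight_def
  by (intro sum_nonneg mult_nonneg_nonneg prod_vnorm_nonneg) (auto simp: formal_sums_def)

lemma weight_add:
  assumes "u \<in> formals" "v \<in> formals"
  shows "weight (\<lambda>z. u z + v z) \<le> weight u + weight v"
proof -
  let ?S = "{x. u x \<noteq> 0} \<union> {x. v x \<noteq> 0}"
  have S: "finite ?S" "?S \<subseteq> tuples n X" using assms by (auto simp: formal_sums_def)
  have "weight (\<lambda>z. u z + v z) = (\<Sum>x\<in>?S. cmod (u x + v x) * (\<Prod>i=1..n. vnorm (X i) (x i)))"
    by (rule weight_superset[OF S(1)]) auto
  also have "\<dots> \<le> (\<Sum>x\<in>?S. cmod (u x) * (\<Prod>i=1..n. vnorm (X i) (x i))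
      + cmod (v x) * (\<Prod>i=1..n. vnorm (X i) (x i)))"
    unfolding distrib_right[symmetric] using S(2)
    by (intro sum_mono mult_right_mono norm_triangle_ineq prod_vnorm_nonneg) auto
  also have "\<dots> = weight u + weight v"
    using weight_superset[OF S(1), of u] weight_superset[OF S(1), of v] by (simp add: sum.distrib)
  finally show ?thesis .
qed

lemma weight_minus: "weight (\<lambda>z. - u z) = weight u"
  by (simp add: weight_def)

lemma vnorm_P: "vnorm P p = Inf (weight ` p)"
  by (simp add: projective_tensor_def weight_def)

lemma tclass_formals: "v \<in> tclass u \<Longrightarrow> v \<in> formals"
  by (auto simp: tensor_rel_def)

lemma vnorm_P_le:
  assumes "v \<in> tclass u"
  shows "vnorm P (tclass u) \<le> weight v"
  unfolding vnorm_P using assms tclass_formals[of _ u] weight_nonneg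
  by (intro cInf_lower) (auto intro!: bdd_belowI[of _ 0])

lemma vnorm_P_ge:
  assumes "u \<in> formals" "\<And>v. v \<in> tclass u \<Longrightarrow> r \<le> weight v"
  shows "r \<le> vnorm P (tclass u)"
  unfolding vnorm_P using assms equiv_class_self[OF equiv_tensor_rel assms(1)]
  by (intro cInf_greatest) auto

lemma vnorm_P_zero: "vnorm P (tclass (\<lambda>z. 0)) = 0"
proof (rule antisym)
  have "(\<lambda>z. 0) \<in> tclass (\<lambda>z. 0)"
    using equiv_class_self[OF equiv_tensor_rel formals_zero] .
  from vnorm_P_le[OF this] show "vnorm P (tclass (\<lambda>z. 0)) \<le> 0" by (simp add: weight_def)
  show "0 \<le> vnorm P (tclass (\<lambda>z. 0))"
    using tclass_formals weight_nonneg by (intro vnorm_P_ge formals_zero) blast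
qed

lemma vnorm_P_triangle:
  assumes "u \<in> formals" "v \<in> formals"
  shows "vnorm P (tclass (\<lambda>z. u z + v z)) \<le> vnorm P (tclass u) + vnorm P (tclass v)"
proof -
  have le: "vnorm P (tclass (\<lambda>z. u z + v z)) \<le> weight u' + weight v'"
    if "u' \<in> tclass u" "v' \<in> tclass v" for u' v'
  proof -
    have "(\<lambda>z. u' z + v' z) \<in> tclass (\<lambda>z. u z + v z)" using tensor_rel_add that by simp
    from vnorm_P_le[OF this] show ?thesis
      using weight_add[OF tclass_formals[OF that(1)] tclass_formals[OF that(2)]] by linarith
  qed
  \<comment> \<open>The two infima are taken in turn: over representatives of \<open>u\<close> with
    \<open>v'\<close> fixed, then over \<open>v'\<close>.\<close>
  have "vnorm P (tclass (\<lambda>z. u z + v z)) - weight v' \<le> vnorm P (tclass u)" if "v' \<in> tclass v" for v'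
    using le[OF _ that] by (intro vnorm_P_ge assms) (simp add: algebra_simps)
  then have "vnorm P (tclass (\<lambda>z. u z + v z)) - vnorm P (tclass u) \<le> vnorm P (tclass v)"
    by (intro vnorm_P_ge assms) (simp add: algebra_simps)
  then show ?thesis by simp
qed

lemma vnorm_P_minus:
  assumes "u \<in> formals"
  shows "vnorm P (tclass (\<lambda>z. - u z)) = vnorm P (tclass u)"
proof -
  have le: "vnorm P (tclass (\<lambda>z. - u z)) \<le> vnorm P (tclass u)" if u: "u \<in> formals" for u
  proof (rule vnorm_P_ge[OF u])
    fix v assume "v \<in> tclass u"
    then have "(\<lambda>z. - v z) \<in> tclass (\<lambda>z. - u z)"
      using tensor_rel_scale[of "- 1" u v] of_real_mem[of "- 1"] by simp
    from vnorm_P_le[OF this] show "vnorm P (tclass (\<lambda>z. - u z)) \<le> weight v"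
      by (simp add: weight_minus)
  qed
  show ?thesis using le[OF assms] le[OF tclass_neg(1)[OF assms]] by simp
qed

lemma vdist_P:
  "u \<in> formals \<Longrightarrow> v \<in> formals \<Longrightarrow> vdist P (tclass u) (tclass v) = vnorm P (tclass (\<lambda>z. u z - v z))"
  by (simp add: vdist_def tclass_minus)

lemma vdist_P_self: "p \<in> carrier P \<Longrightarrow> vdist P p p = 0"
  by (erule P_cases) (simp add: vdist_P vnorm_P_zero)

text \<open>The triangle inequality is used in both directions, for q = p + (q - p) and p = q + (p -
  q). It makes the norm continuous, so norms converge along the representatives of a class in the
  completion.\<close>

lemma vnorm_P_diff_le:
  assumes "p \<in> carrier P" "q \<in> carrier P"
  shows "\<bar>vnorm P q - vnorm P p\<bar> \<le> vdist P p q"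
proof -
  obtain u v where uv: "u \<in> formals" "p = tclass u" "v \<in> formals" "q = tclass v"
    using assms by (metis P_cases)
  show ?thesis
    using vnorm_P_triangle[OF uv(3) formals_diff[OF uv(1,3)]]
      vnorm_P_triangle[OF uv(1) formals_diff[OF uv(3,1)]]
      vnorm_P_minus[OF formals_diff[OF uv(1,3)]] uv
    by (simp add: vdist_P)
qed

section \<open>Constant sequences in the completion\<close>

abbreviation "const_class p \<equiv> cauchy_rel P `` {\<lambda>k. p}"
abbreviation "PC \<equiv> completed_projective_tensor K n X"

lemma PC_add: "p \<oplus>\<^bsub>PC\<^esub> q = (\<Union>s\<in>p. \<Union>t\<in>q. cauchy_rel P `` {\<lambda>k. s k \<oplus>\<^bsub>P\<^esub> t k})"
  and PC_smult: "c \<odot>\<^bsub>PC\<^esub> p = (\<Union>s\<in>p. cauchy_rel P `` {\<lambda>k. c \<odot>\<^bsub>P\<^esub> s k})"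
  by (simp_all add: completed_projective_tensor_def completion_def)

lemma vCauchy_const: "p \<in> carrier P \<Longrightarrow> vCauchy P (\<lambda>k. p)"
  by (simp add: vCauchy_def vdist_P_self)

lemma const_class_self: "p \<in> carrier P \<Longrightarrow> (\<lambda>k. p) \<in> const_class p"
  by (simp add: cauchy_rel_def vCauchy_const vdist_P_self)

lemma const_class_dist: "(\<lambda>k. q) \<in> const_class p \<Longrightarrow> vdist P p q = 0"
  by (simp add: cauchy_rel_def LIMSEQ_const_iff)

lemma const_class_eqD:
  assumes "p \<in> carrier P" "q \<in> carrier P" "const_class p = const_class q"
  shows "vdist P p q = 0"
  using const_class_self[OF assms(2)] assms(3) by (intro const_class_dist) simp

text \<open>Addition in the completion is a union over representatives. Choosing the constant ones
  shows that the union contains the constant sequence of the sum, and one such member determines the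
  distance.\<close>

lemma const_class_addD:
  assumes "q \<in> carrier P" "r \<in> carrier P"
    and eq: "const_class p = const_class q \<oplus>\<^bsub>PC\<^esub> const_class r"
  shows "vdist P p (q \<oplus>\<^bsub>P\<^esub> r) = 0"
proof (rule const_class_dist)
  interpret P: abelian_group P by (rule abelian_group_P)
  have "q \<oplus>\<^bsub>P\<^esub> r \<in> carrier P" using assms(1,2) by simp
  then show "(\<lambda>k. q \<oplus>\<^bsub>P\<^esub> r) \<in> const_class p"
    unfolding eq PC_add
    by (intro UN_I[OF const_class_self[OF assms(1)]] UN_I[OF const_class_self[OF assms(2)]]
        const_class_self)
qed

lemma const_class_smultD:
  assumes "q \<in> carrier P" "c \<odot>\<^bsub>P\<^esub> q \<in> carrier P"
    and eq: "const_class p = c \<odot>\<^bsub>PC\<^esub> const_class q"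
  shows "vdist P p (c \<odot>\<^bsub>P\<^esub> q) = 0"
proof (rule const_class_dist)
  show "(\<lambda>k. c \<odot>\<^bsub>P\<^esub> q) \<in> const_class p"
    unfolding eq PC_smult
    by (intro UN_I[OF const_class_self[OF assms(1)]] const_class_self assms(2))
qed

text \<open>The norm of a class is a definite description of a limit. All representatives have the
  same limit of norms as the constant one, which gives both existence and uniqueness.\<close>

lemma vnorm_const_class:
  assumes p: "p \<in> carrier P"
  shows "vnorm PC (const_class p) = vnorm P p"
proof -
  have lim: "(\<lambda>k. vnorm P (s k)) \<longlonglongrightarrow> vnorm P p" if s: "s \<in> const_class p" for s
  proof -
    have sc: "s k \<in> carrier P" for k using s by (auto simp: cauchy_rel_def vCauchy_def)
    have "(\<lambda>k. vdist P p (s k)) \<longlonglongrightarrow> 0" using s by (simp add: cauchy_rel_def)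
    then have "(\<lambda>k. \<bar>vnorm P (s k) - vnorm P p\<bar>) \<longlonglongrightarrow> 0"
      by (rule tendsto_sandwich[OF _ _ tendsto_const, rotated 2])
         (simp_all only: vnorm_P_diff_le[OF p sc] abs_ge_zero eventually_True)
    then have "(\<lambda>k. vnorm P (s k) - vnorm P p) \<longlonglongrightarrow> 0" by (rule tendsto_rabs_zero_cancel)
    then show ?thesis by (rule LIM_zero_cancel)
  qed
  have "(THE r. \<exists>s\<in>const_class p. (\<lambda>k. vnorm P (s k)) \<longlonglongrightarrow> r) = vnorm P p"
  proof (rule the_equality)
    show "\<exists>s\<in>const_class p. (\<lambda>k. vnorm P (s k)) \<longlonglongrightarrow> vnorm P p"
      by (intro bexI[of _ "\<lambda>k. p"] const_class_self[OF p]) simp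
  next
    fix r assume "\<exists>s\<in>const_class p. (\<lambda>k. vnorm P (s k)) \<longlonglongrightarrow> r"
    then obtain s where s: "s \<in> const_class p" "(\<lambda>k. vnorm P (s k)) \<longlonglongrightarrow> r" ..
    show "r = vnorm P p" using s(2) lim[OF s(1)] by (rule LIMSEQ_unique)
  qed
  then show ?thesis by (simp add: completed_projective_tensor_def completion_def)
qed

lemma pure_tensor_eq: "pure_tensor K n X x = const_class (tclass (single x))"
  by (simp add: pure_tensor_def)

section \<open>The linearization of a bounded multilinear operator\<close>

context
  fixes Y :: "'b nspace" and T :: "(nat \<Rightarrow> 'a) \<Rightarrow> 'b" and a :: real
  assumes Y: "normed_space K Y" and T: "multilinear K n X Y T"
    and a: "\<And>x. x \<in> unit_tuples n X \<Longrightarrow> vnorm Y (T x) \<le> a" and a0: "0 \<le> a"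
begin

interpretation Y: normed_space K Y by (rule Y)

lemma T_fun: "T \<in> tuples n X \<rightarrow> carrier Y"
  using T by (simp add: multilinear_def)

lemmas lincomb_plus = Y.lincomb_add(2)[OF T_fun _ _ field]
  and lincomb_scale = Y.lincomb_smult(2)[OF T_fun _ _ field]
  and lincomb_single = Y.lincomb_single(2)[OF T_fun _ field]
  and lincomb_closed = Y.lincomb_closed[OF T_fun]

lemma lincomb_diff:
  assumes "u \<in> formals" "v \<in> formals"
  shows "Y.lincomb T (\<lambda>z. u z - v z) = Y.lincomb T u \<ominus>\<^bsub>Y\<^esub> Y.lincomb T v"
  using lincomb_plus[OF assms(1) formals_scale[OF Y.neg_one_mem assms(2)]]
    lincomb_scale[OF assms(2) Y.neg_one_mem] lincomb_closed assms
  by (simp add: Y.minus_eq_scale)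

text \<open>Multilinearity of \<open>T\<close> says that the linear extension kills every generator;
  its linearity extends this to their combinations.\<close>

lemma lincomb_relations: "u \<in> relations \<Longrightarrow> Y.lincomb T u = \<zero>\<^bsub>Y\<^esub>"
proof (induction rule: multilinear_relations.induct)
  case zero
  show ?case by (simp add: Y.lincomb_def)
next
  case (add u c x i a b)
  let ?s = "\<lambda>z. single (x(i := a \<oplus>\<^bsub>X i\<^esub> b)) z - single (x(i := a)) z"
  let ?t = "\<lambda>z. ?s z - single (x(i := b)) z"
  note t = tuples_update[OF add.hyps(3,4)]
  note t = t[OF factors_add_closed[OF add.hyps(4-6)]] t[OF add.hyps(5)] t[OF add.hyps(6)]
  note F = t[THEN formals_single]
  note c = T_fun[THEN funcset_mem, OF t(2)] T_fun[THEN funcset_mem, OF t(3)]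
  have "Y.lincomb T ?t = (T (x(i := a)) \<oplus>\<^bsub>Y\<^esub> T (x(i := b))) \<ominus>\<^bsub>Y\<^esub> T (x(i := a)) \<ominus>\<^bsub>Y\<^esub> T (x(i := b))"
    using lincomb_diff[OF formals_diff[OF F(1,2)] F(3)] lincomb_diff[OF F(1,2)] lincomb_single[OF t(1)]
      lincomb_single[OF t(2)] lincomb_single[OF t(3)] multilinear_add[OF T add.hyps(3-6)]
    by simp
  also have "\<dots> = (T (x(i := a)) \<oplus>\<^bsub>Y\<^esub> T (x(i := b))) \<oplus>\<^bsub>Y\<^esub> \<ominus>\<^bsub>Y\<^esub> (T (x(i := a)) \<oplus>\<^bsub>Y\<^esub> T (x(i := b)))"
    using c by (simp add: a_minus_def Y.M.a_assoc Y.M.minus_add)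
  also have "\<dots> = \<zero>\<^bsub>Y\<^esub>"
    using c by (intro Y.M.r_neg) simp
  finally have t0: "Y.lincomb T ?t = \<zero>\<^bsub>Y\<^esub>" .
  have Ft: "?t \<in> formals" by (intro formals_diff F)
  show ?case
    using lincomb_plus[OF relations_subset[OF add.hyps(1)] formals_scale[OF add.hyps(2) Ft]]
      lincomb_scale[OF Ft add.hyps(2)] t0 add.IH add.hyps(2) by simp
next
  case (smult u c x i r a)
  let ?t = "\<lambda>z. single (x(i := r \<odot>\<^bsub>X i\<^esub> a)) z - r * single (x(i := a)) z"
  note t = tuples_update[OF smult.hyps(3,4)]
  note t = t[OF factors_smult_closed[OF smult.hyps(4-6)]] t[OF smult.hyps(6)]
  note F = t[THEN formals_single]
  note c = T_fun[THEN funcset_mem, OF t(2)]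
  have "Y.lincomb T ?t = r \<odot>\<^bsub>Y\<^esub> T (x(i := a)) \<ominus>\<^bsub>Y\<^esub> r \<odot>\<^bsub>Y\<^esub> T (x(i := a))"
    using lincomb_diff[OF F(1) formals_scale[OF smult.hyps(5) F(2)]] lincomb_single[OF t(1)]
      lincomb_single[OF t(2)] lincomb_scale[OF F(2) smult.hyps(5)] multilinear_smult[OF T smult.hyps(3-6)]
    by simp
  also have "\<dots> = \<zero>\<^bsub>Y\<^esub>"
    using c smult.hyps(5) by (simp add: a_minus_def Y.M.r_neg)
  finally have t0: "Y.lincomb T ?t = \<zero>\<^bsub>Y\<^esub>" .
  have Ft: "?t \<in> formals" by (intro formals_diff formals_scale F smult.hyps)
  show ?case
    using lincomb_plus[OF relations_subset[OF smult.hyps(1)] formals_scale[OF smult.hyps(2) Ft]]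
      lincomb_scale[OF Ft smult.hyps(2)] t0 smult.IH smult.hyps(2) by simp
qed

lemma lincomb_tclass:
  assumes "v \<in> tclass u"
  shows "Y.lincomb T v = Y.lincomb T u"
proof -
  have uv: "u \<in> formals" "v \<in> formals" "(\<lambda>z. u z - v z) \<in> relations"
    using assms by (auto simp: tensor_rel_def)
  have "Y.lincomb T u = Y.lincomb T (\<lambda>z. v z + (u z - v z))" by simp
  also have "\<dots> = Y.lincomb T v"
    using lincomb_plus[OF uv(2) relations_subset[OF uv(3)]] lincomb_relations[OF uv(3)]
      lincomb_closed[OF uv(2)] by simp
  finally show ?thesis by simp
qed

lemma vnorm_lincomb_le_weight:
  assumes "v \<in> formals"
  shows "vnorm Y (Y.lincomb T v) \<le> a * weight v"
proof -
  let ?S = "{x. v x \<noteq> 0}"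
  have S: "finite ?S" "\<And>x. x \<in> ?S \<Longrightarrow> x \<in> tuples n X" and vK: "\<And>x. v x \<in> K"
    using assms by (auto simp: formal_sums_def)
  have Tc: "T x \<in> carrier Y" if "x \<in> ?S" for x using T_fun S(2)[OF that] by auto
  have "vnorm Y (Y.lincomb T v) \<le> (\<Sum>x\<in>?S. vnorm Y (v x \<odot>\<^bsub>Y\<^esub> T x))"
    unfolding Y.lincomb_def using S(1) Tc vK by (intro Y.vnorm_finsum_le) auto
  also have "\<dots> \<le> (\<Sum>x\<in>?S. a * (cmod (v x) * (\<Prod>i=1..n. vnorm (X i) (x i))))"
  proof (rule sum_mono)
    fix x assume x: "x \<in> ?S"
    have "vnorm Y (v x \<odot>\<^bsub>Y\<^esub> T x) = cmod (v x) * vnorm Y (T x)"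
      using Y.vnorm_smult[OF vK Tc[OF x]] .
    also have "\<dots> \<le> cmod (v x) * (a * (\<Prod>i=1..n. vnorm (X i) (x i)))"
      using multilinear_bound[OF Y T a S(2)[OF x]] by (intro mult_left_mono) auto
    finally show "vnorm Y (v x \<odot>\<^bsub>Y\<^esub> T x) \<le> a * (cmod (v x) * (\<Prod>i=1..n. vnorm (X i) (x i)))"
      by (simp add: ac_simps)
  qed
  also have "\<dots> = a * weight v" by (simp add: weight_def sum_distrib_left)
  finally show ?thesis .
qed

text \<open>The linear extension has the same value on all representatives, so the bound by their
  weights may be passed to the infimum. The case \<open>a = 0\<close> is apart because the infimum
  is reached after division by \<open>a\<close>.\<close>

lemma vnorm_lincomb_le:
  assumes "u \<in> formals"
  shows "vnorm Y (Y.lincomb T u) \<le> a * vnorm P (tclass u)"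
proof -
  have le: "vnorm Y (Y.lincomb T u) \<le> a * weight v" if "v \<in> tclass u" for v
    using vnorm_lincomb_le_weight[OF tclass_formals[OF that]] lincomb_tclass[OF that] by simp
  show ?thesis
  proof (cases "a = 0")
    case True
    then show ?thesis using vnorm_lincomb_le_weight[OF assms] by simp
  next
    case False
    then have "0 < a" using a0 by simp
    then have "vnorm Y (Y.lincomb T u) / a \<le> vnorm P (tclass u)"
      using le by (intro vnorm_P_ge assms) (simp add: divide_le_eq mult.commute)
    then show ?thesis using \<open>0 < a\<close> by (simp add: divide_le_eq mult.commute)
  qed
qed

text \<open>The hypothesis is distance zero, as this is what an equality of classes in the
  completion delivers; boundedness for the projective norm turns it into equality of values.\<close>

lemma lincomb_eqI:
  assumes "u \<in> formals" "v \<in> formals" "vdist P (tclass u) (tclass v) = 0"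
  shows "Y.lincomb T u = Y.lincomb T v"
proof (rule Y.vdist_eq_0)
  show "Y.lincomb T u \<in> carrier Y" "Y.lincomb T v \<in> carrier Y" using lincomb_closed assms by auto
  then show "vdist Y (Y.lincomb T u) (Y.lincomb T v) = 0"
    using vnorm_lincomb_le[OF formals_diff[OF assms(1,2)]] lincomb_diff[OF assms(1,2)]
      assms(3)[unfolded vdist_P[OF assms(1,2)]] Y.vdist_nonneg[of "Y.lincomb T u" "Y.lincomb T v"]
    by (simp add: vdist_def)
qed

lemma vnorm_le_pure_tensor:
  "x \<in> tuples n X \<Longrightarrow> vnorm Y (T x) \<le> a * vnorm PC (pure_tensor K n X x)"
  using vnorm_lincomb_le[OF formals_single] lincomb_single formals_single
  by (simp add: pure_tensor_eq vnorm_const_class)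

text \<open>This is the well-definedness of f_T on decomposable tensors.\<close>

lemma pure_tensor_cong:
  assumes x: "x \<in> tuples n X" "y \<in> tuples n X" and eq: "pure_tensor K n X x = pure_tensor K n X y"
  shows "T x = T y"
proof -
  note F = x[THEN formals_single]
  show ?thesis
    using lincomb_eqI[OF F const_class_eqD[OF F[THEN tclass_closed] eq[unfolded pure_tensor_eq]]]
      x[THEN lincomb_single] by simp
qed

text \<open>A sum of decomposable tensors need not be decomposable. Additivity is claimed where it
  is, a situation that arises along \<open>R\<close>.\<close>

lemma pure_tensor_add:
  assumes x: "x \<in> tuples n X" "y \<in> tuples n X" "w \<in> tuples n X"
    and eq: "pure_tensor K n X x = pure_tensor K n X y \<oplus>\<^bsub>PC\<^esub> pure_tensor K n X w"
  shows "T x = T y \<oplus>\<^bsub>Y\<^esub> T w"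
proof -
  note F = x[THEN formals_single]
  have "vdist P (tclass (single x)) (tclass (\<lambda>z. single y z + single w z)) = 0"
    using const_class_addD[OF F(2,3)[THEN tclass_closed] eq[unfolded pure_tensor_eq]] F(2,3) by simp
  from lincomb_eqI[OF F(1) formals_add[OF F(2,3)] this] show ?thesis
    using x[THEN lincomb_single] lincomb_plus[OF F(2,3)] by simp
qed

lemma pure_tensor_smult:
  assumes x: "x \<in> tuples n X" "y \<in> tuples n X" and c: "c \<in> K"
    and eq: "pure_tensor K n X x = c \<odot>\<^bsub>PC\<^esub> pure_tensor K n X y"
  shows "T x = c \<odot>\<^bsub>Y\<^esub> T y"
proof -
  note F = x[THEN formals_single]
  note s = tclass_smult[OF c F(2)] formals_scale[OF c F(2)]
  have "vdist P (tclass (single x)) (tclass (\<lambda>z. c * single y z)) = 0"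
    using const_class_smultD[OF F(2)[THEN tclass_closed] _ eq[unfolded pure_tensor_eq]] s by simp
  from lincomb_eqI[OF F(1) s(2) this] show ?thesis
    using x[THEN lincomb_single] lincomb_scale[OF F(2) c] by simp
qed

lemma tensor_map_pure:
  assumes x: "x \<in> tuples n X"
  shows "tensor_map K n X T (pure_tensor K n X x) = T x"
  unfolding tensor_map_def using x pure_tensor_cong by (intro the_equality) blast+

end

end

section \<open>Composition with multilinear and linear operators\<close>

lemma
  assumes K: "K = \<real> \<or> K = UNIV" and V: "normed_space K V" and W: "normed_space K W"
    and S: "bounded_linear_op K V W S"
  shows opnorm_nonneg: "0 \<le> opnorm V W S"
    and opnorm_vdist:
      "x \<in> carrier V \<Longrightarrow> y \<in> carrier V \<Longrightarrow> vdist W (S x) (S y) \<le> opnorm V W S * vdist V x y"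
proof -
  interpret V: normed_space K V by (rule V)
  interpret W: normed_space K W by (rule W)
  have Sc: "S x \<in> carrier W" if "x \<in> carrier V" for x
    using S that by (auto simp: bounded_linear_op_def)
  have add: "S (x \<oplus>\<^bsub>V\<^esub> y) = S x \<oplus>\<^bsub>W\<^esub> S y" if "x \<in> carrier V" "y \<in> carrier V" for x y
    using S that by (simp add: bounded_linear_op_def)
  have scale: "S (c \<odot>\<^bsub>V\<^esub> x) = c \<odot>\<^bsub>W\<^esub> S x" if "c \<in> K" "x \<in> carrier V" for c x
    using S that by (simp add: bounded_linear_op_def)
  have upper: "vnorm W (S x) \<le> opnorm V W S" if "x \<in> carrier V" "vnorm V x \<le> 1" for x
    unfolding opnorm_def using S that by (intro cSup_upper) (auto simp: bounded_linear_op_def)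
  show "0 \<le> opnorm V W S"
    using upper[of "\<zero>\<^bsub>V\<^esub>"] W.vnorm_nonneg[OF Sc[of "\<zero>\<^bsub>V\<^esub>"]] by simp
  have bound: "vnorm W (S x) \<le> opnorm V W S * vnorm V x" if x: "x \<in> carrier V" for x
  proof (cases "vnorm V x = 0")
    case True
    then have "x = 0 \<odot>\<^bsub>V\<^esub> x" using x V.vnorm_eq_0_iff[OF x] by simp
    then have "S x = 0 \<odot>\<^bsub>W\<^esub> S x" using scale[of 0 x] x K by auto
    then have "S x = \<zero>\<^bsub>W\<^esub>" using Sc[OF x] by simp
    then show ?thesis using True by simp
  next
    case False
    then have p: "0 < vnorm V x" using V.vnorm_nonneg[OF x] by simp
    define c where "c = complex_of_real (1 / vnorm V x)"
    have c: "c \<in> K" "cmod c = 1 / vnorm V x" using K p by (auto simp: c_def norm_divide)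
    have "vnorm W (S (c \<odot>\<^bsub>V\<^esub> x)) \<le> opnorm V W S"
      using c x p by (intro upper) (simp_all add: V.vnorm_smult)
    then show ?thesis
      using c x p Sc[OF x] by (simp add: scale W.vnorm_smult divide_le_eq)
  qed
  show "vdist W (S x) (S y) \<le> opnorm V W S * vdist V x y" if "x \<in> carrier V" "y \<in> carrier V"
    using bound[of "x \<ominus>\<^bsub>V\<^esub> y"] that Sc V.neg_one_mem
    by (simp add: vdist_def V.minus_eq_scale W.minus_eq_scale add scale)
qed

lemma multilinear_compose_linear:
  assumes T: "multilinear K n X Y T" and S: "bounded_linear_op K Y W S"
  shows "multilinear K n X W (\<lambda>x. S (T x))"
  using T S multilinear_closed[OF T] unfolding multilinear_def bounded_linear_op_def
  by auto

text \<open>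
  A factorization \<open>T = B \<circ> A\<close> turns \<open>S f\<^sub>T R\<close> into \<open>(S \<circ> B) \<circ> (f\<^sub>A \<circ> R)\<close>, and \<open>f\<^sub>A\<close> is the
  restriction of a bounded linear operator, so \<open>f\<^sub>A \<circ> R\<close> is multilinear although
  \<open>\<Sigma>\<close> is not a subspace.
\<close>

lemma (in factor_spaces_target) Gamma_compose:
  fixes Z :: "nat \<Rightarrow> 'c nspace" and W :: "'d nspace"
  assumes Z: "factor_spaces K m Z" and W: "normed_space K W"
    and R: "bounded_multilinear K m Z PC R"
    and dec: "R ` tuples m Z \<subseteq> decomposable_tensors K n X"
    and S: "bounded_linear_op K Y W S"
    and T: "T \<in> carrier \<Gamma>"
  shows "(\<lambda>z\<in>tuples m Z. S (tensor_map K n X T (R z))) \<in> carrier (Gamma_space K m Z W)"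
    and "Gamma_norm K m Z W (\<lambda>z\<in>tuples m Z. S (tensor_map K n X T (R z)))
      \<le> mnorm m Z PC R * Gamma_norm K n X Y T * opnorm Y W S"
proof -
  interpret Z: factor_spaces_target K m Z W
    using Z W by (intro factor_spaces_target.intro)
  note Yn = Y.normed_space_axioms
  have mR: "multilinear K m Z PC R" using R by (simp add: bounded_multilinear_def)
  have "\<forall>z\<in>tuples m Z. \<exists>x. x \<in> tuples n X \<and> R z = pure_tensor K n X x"
    using dec by (auto simp: decomposable_tensors_def)
  \<comment> \<open>A chosen representation of each value of \<open>R\<close>. The choice itself
    need not be multilinear, but an operator composed with it depends only on the tensor.\<close>
  then obtain \<rho> where \<rho>: "\<And>z. z \<in> tuples m Z \<Longrightarrow> \<rho> z \<in> tuples n X"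
      "\<And>z. z \<in> tuples m Z \<Longrightarrow> pure_tensor K n X (\<rho> z) = R z"
    by (auto dest!: bchoice)
  \<comment> \<open>Stated for a general target because it serves both \<open>T\<close> and the map
    \<open>A\<close> into a Hilbert space.\<close>
  have pullback: "multilinear K m Z V (\<lambda>z. U (\<rho> z))"
    if V: "normed_space K V" and U: "multilinear K n X V U"
      "\<And>x. x \<in> unit_tuples n X \<Longrightarrow> vnorm V (U x) \<le> b" "0 \<le> b"
    for V :: "'v nspace" and U b
    unfolding multilinear_def
  proof (intro conjI ballI)
    show "(\<lambda>z. U (\<rho> z)) \<in> tuples m Z \<rightarrow> carrier V" using \<rho>(1) multilinear_closed[OF U(1)] by auto
  next
    fix z i a b assume z: "z \<in> tuples m Z" "i \<in> {1..m}" and ab: "a \<in> carrier (Z i)" "b \<in> carrier (Z i)"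
    note t = tuples_update[OF z Z.factors_add_closed[OF z(2) ab]]
      tuples_update[OF z ab(1)] tuples_update[OF z ab(2)]
    show "U (\<rho> (z(i := a \<oplus>\<^bsub>Z i\<^esub> b))) = U (\<rho> (z(i := a))) \<oplus>\<^bsub>V\<^esub> U (\<rho> (z(i := b)))"
      using multilinear_add[OF mR z ab] \<rho>(2)[OF t(1)] \<rho>(2)[OF t(2)] \<rho>(2)[OF t(3)]
      by (intro pure_tensor_add[OF V U \<rho>(1)[OF t(1)] \<rho>(1)[OF t(2)] \<rho>(1)[OF t(3)]]) auto
  next
    fix z i c a assume z: "z \<in> tuples m Z" "i \<in> {1..m}" and c: "c \<in> K" and a: "a \<in> carrier (Z i)"
    note t = tuples_update[OF z Z.factors_smult_closed[OF z(2) c a]] tuples_update[OF z a]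
    show "U (\<rho> (z(i := c \<odot>\<^bsub>Z i\<^esub> a))) = c \<odot>\<^bsub>V\<^esub> U (\<rho> (z(i := a)))"
      using multilinear_smult[OF mR z c a] \<rho>(2)[OF t(1)] \<rho>(2)[OF t(2)]
      by (intro pure_tensor_smult[OF V U \<rho>(1)[OF t(1)] \<rho>(1)[OF t(2)] c]) auto
  qed
  have mT: "multilinear K n X Y T" and facT: "factors_through_hilbert K n X Y T" using T by auto
  \<comment> \<open>\<Gamma>(T) is a nonnegative bound for \<open>T\<close> on the unit ball, as the
    results on linearizations require.\<close>
  note T' = Yn mT vnorm_le_Gamma_norm[OF T] Gamma_norm_nonneg[OF facT]
  have eq: "(\<lambda>z\<in>tuples m Z. S (tensor_map K n X T (R z))) = (\<lambda>z\<in>tuples m Z. S (T (\<rho> z)))"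
    using tensor_map_pure[OF T' \<rho>(1)] \<rho>(2) by (auto simp: restrict_def fun_eq_iff)
  have mS: "multilinear K m Z W (\<lambda>z. S (T (\<rho> z)))"
    by (rule multilinear_compose_linear[OF pullback[OF T'] S])
  have Rle: "vnorm PC (R z) \<le> mnorm m Z PC R" if "z \<in> unit_tuples m Z" for z
    by (rule Z.mnorm_upper[OF R that])
  \<comment> \<open>\<open>Z.mnorm_nonneg\<close> asks for a normed target. Here nonnegativity is
    checked on the values of \<open>R\<close>, which are decomposable and so have the norm of a
    class of formal sums.\<close>
  have R0: "0 \<le> vnorm PC (R z)" if z: "z \<in> tuples m Z" for z
  proof -
    note F = formals_single[OF \<rho>(1)[OF z]]
    have "0 \<le> vnorm P (tclass (single (\<rho> z)))"
      using tclass_formals weight_nonneg by (intro vnorm_P_ge F) blast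
    then show ?thesis
      using vnorm_const_class[OF tclass_closed[OF F]] \<rho>(2)[OF z] by (simp add: pure_tensor_eq)
  qed
  have mR0: "0 \<le> mnorm m Z PC R"
    using R0[of Z.zero_tuple] Rle[OF Z.zero_tuple_mem] Z.zero_tuple_mem by (simp add: unit_tuples_def)
  note S0 = opnorm_nonneg[OF field Yn W S]
  have main: "(\<lambda>z\<in>tuples m Z. S (T (\<rho> z))) \<in> carrier (Gamma_space K m Z W) \<and>
      Gamma_norm K m Z W (\<lambda>z\<in>tuples m Z. S (T (\<rho> z))) \<le> (mnorm m Z PC R * opnorm Y W S) * g"
    if g: "Gamma_norm K n X Y T < g" for g
  proof -
    obtain H :: "'a hvec nspace" and A a L
      where dom: "hilbert_dominated K n X Y T H A a L" "0 \<le> a" "0 \<le> L" "a * L < g"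
      using facT g by (rule hilbert_dominated_of_Gamma_less)
    have H: "hilbert_space K H" and mA: "multilinear K n X H A"
      and Aa: "\<And>x. x \<in> unit_tuples n X \<Longrightarrow> vnorm H (A x) \<le> a"
      and lip: "\<And>x y. x \<in> tuples n X \<Longrightarrow> y \<in> tuples n X \<Longrightarrow>
        vdist Y (T x) (T y) \<le> L * vdist H (A x) (A y)"
      using dom(1) by (auto simp: hilbert_dominated_def)
    note A' = hilbert_space_normed[OF H] mA Aa dom(2)
    have "vnorm H (A (\<rho> z)) \<le> a * mnorm m Z PC R" if z: "z \<in> unit_tuples m Z" for z
    proof -
      have zt: "z \<in> tuples m Z" using z by (simp add: unit_tuples_def)
      have "vnorm H (A (\<rho> z)) \<le> a * vnorm PC (R z)"
        using vnorm_le_pure_tensor[OF A' \<rho>(1)[OF zt]] \<rho>(2)[OF zt] by simp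
      also have "\<dots> \<le> a * mnorm m Z PC R" using Rle[OF z] dom(2) by (rule mult_left_mono)
      finally show ?thesis .
    qed
    moreover have "vdist W (S (T (\<rho> z))) (S (T (\<rho> z'))) \<le> opnorm Y W S * L * vdist H (A (\<rho> z)) (A (\<rho> z'))"
      if z: "z \<in> tuples m Z" "z' \<in> tuples m Z" for z z'
    proof -
      note \<rho>z = z[THEN \<rho>(1)]
      have "vdist W (S (T (\<rho> z))) (S (T (\<rho> z'))) \<le> opnorm Y W S * vdist Y (T (\<rho> z)) (T (\<rho> z'))"
        using \<rho>z[THEN multilinear_closed[OF mT]] by (intro opnorm_vdist[OF field Yn W S])
      also have "\<dots> \<le> opnorm Y W S * (L * vdist H (A (\<rho> z)) (A (\<rho> z')))"
        using lip[OF \<rho>z] S0 by (rule mult_left_mono)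
      finally show ?thesis by (simp add: mult.assoc)
    qed
    \<comment> \<open>\<open>H\<close> keeps the vector type belonging to the \<open>X i\<close>,
      although the factors are now the \<open>Z j\<close>; \<open>Z.Gamma_domI\<close> accepts any
      type and performs the change.\<close>
    ultimately have "hilbert_dominated K m Z W (\<lambda>z. S (T (\<rho> z))) H (\<lambda>z. A (\<rho> z))
        (a * mnorm m Z PC R) (opnorm Y W S * L)"
      using H pullback[OF A'] by (simp add: hilbert_dominated_def)
    note Z.Gamma_domI[OF mS _ this]
    moreover have "0 \<le> opnorm Y W S * L" using S0 dom(3) by simp
    moreover have "a * mnorm m Z PC R * (opnorm Y W S * L) \<le> (mnorm m Z PC R * opnorm Y W S) * g"
      using mult_left_mono[OF less_imp_le[OF dom(4)] mult_nonneg_nonneg[OF mR0 S0]]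
      by (simp add: ac_simps)
    ultimately show ?thesis by (meson order_trans)
  qed
  show "(\<lambda>z\<in>tuples m Z. S (tensor_map K n X T (R z))) \<in> carrier (Gamma_space K m Z W)"
    using main[of "Gamma_norm K n X Y T + 1"] unfolding eq by (simp del: Gamma_space_simps)
  have "Gamma_norm K m Z W (\<lambda>z\<in>tuples m Z. S (T (\<rho> z)))
      \<le> (mnorm m Z PC R * opnorm Y W S) * Gamma_norm K n X Y T"
    by (rule le_mult_dense) (use main mR0 S0 in auto)
  then show "Gamma_norm K m Z W (\<lambda>z\<in>tuples m Z. S (tensor_map K n X T (R z)))
      \<le> mnorm m Z PC R * Gamma_norm K n X Y T * opnorm Y W S"
    unfolding eq by (simp add: ac_simps)
qed

theorem proposition4p1:
  fixes K :: "complex set" and n :: nat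
    and X :: "nat \<Rightarrow> 'a nspace" and Y :: "'b nspace"
  assumes "K = \<real> \<or> K = UNIV"
    and "1 \<le> n"
    and "\<And>i. i \<in> {1..n} \<Longrightarrow> banach_space K (X i)"
    and "banach_space K Y"
  shows
    "normed_space K (Gamma_space K n X Y)
     \<and> (\<forall>\<phi> y. bounded_multilinear K n X (scalar_field K) \<phi> \<and> y \<in> carrier Y \<longrightarrow>
          (\<lambda>x\<in>tuples n X. \<phi> x \<odot>\<^bsub>Y\<^esub> y) \<in> carrier (Gamma_space K n X Y) \<and>
          Gamma_norm K n X Y (\<lambda>x\<in>tuples n X. \<phi> x \<odot>\<^bsub>Y\<^esub> y)
            \<le> mnorm n X (scalar_field K) \<phi> * vnorm Y y)
     \<and> (\<forall>T\<in>carrier (Gamma_space K n X Y).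
          bounded_multilinear K n X Y T \<and> mnorm n X Y T \<le> Gamma_norm K n X Y T)
     \<and> (\<forall>m (Z :: nat \<Rightarrow> 'c nspace) (W :: 'd nspace) R S T.
          1 \<le> m \<and> (\<forall>j\<in>{1..m}. banach_space K (Z j)) \<and> banach_space K W \<and>
          bounded_multilinear K m Z (completed_projective_tensor K n X) R \<and>
          R ` tuples m Z \<subseteq> decomposable_tensors K n X \<and>
          bounded_linear_op K Y W S \<and>
          T \<in> carrier (Gamma_space K n X Y) \<longrightarrow>
          (\<lambda>z\<in>tuples m Z. S (tensor_map K n X T (R z))) \<in> carrier (Gamma_space K m Z W) \<and>
          Gamma_norm K m Z W (\<lambda>z\<in>tuples m Z. S (tensor_map K n X T (R z)))
            \<le> mnorm m Z (completed_projective_tensor K n X) R * Gamma_norm K n X Y T * opnorm Y W S)"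
proof -
  have spaces: "factor_spaces K m Z"
    if "1 \<le> m" "\<forall>j\<in>{1..m}. banach_space K (Z j)" for m and Z :: "nat \<Rightarrow> 'z nspace"
    using that assms(1) by (auto simp: factor_spaces_def banach_space_def)
  interpret factor_spaces_target K n X Y
    using spaces[of n X] assms by (auto simp: factor_spaces_target_def banach_space_def)
  show ?thesis
  proof (intro conjI allI ballI impI; (elim conjE)?)
    show "normed_space K \<Gamma>" by (rule normed_Gamma)
  next
    fix \<phi> y assume "bounded_multilinear K n X (scalar_field K) \<phi>" "y \<in> carrier Y"
    then show "(\<lambda>x\<in>tuples n X. \<phi> x \<odot>\<^bsub>Y\<^esub> y) \<in> carrier \<Gamma>"
      and "Gamma_norm K n X Y (\<lambda>x\<in>tuples n X. \<phi> x \<odot>\<^bsub>Y\<^esub> y) \<le> mnorm n X (scalar_field K) \<phi> * vnorm Y y"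
      by (rule rank_one)+
  next
    fix T assume "T \<in> carrier \<Gamma>"
    then show "bounded_multilinear K n X Y T" "mnorm n X Y T \<le> Gamma_norm K n X Y T"
      by (rule Gamma_bounded)+
  next
    fix m and Z :: "nat \<Rightarrow> 'c nspace" and W :: "'d nspace" and R S T
    assume "1 \<le> m" "\<forall>j\<in>{1..m}. banach_space K (Z j)" "banach_space K W"
      and *: "bounded_multilinear K m Z PC R" "R ` tuples m Z \<subseteq> decomposable_tensors K n X"
        "bounded_linear_op K Y W S" "T \<in> carrier \<Gamma>"
    then have "factor_spaces K m Z" "normed_space K W"
      using spaces by (auto simp: banach_space_def)
    from Gamma_compose[OF this *]
    show "(\<lambda>z\<in>tuples m Z. S (tensor_map K n X T (R z))) \<in> carrier (Gamma_space K m Z W)"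
      and "Gamma_norm K m Z W (\<lambda>z\<in>tuples m Z. S (tensor_map K n X T (R z)))
        \<le> mnorm m Z PC R * Gamma_norm K n X Y T * opnorm Y W S" .
  qed
qed

end
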